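(* Let $(\mathfrak{X}_1, \Gamma_1, \Phi_1)$ and $(\mathfrak{X}_2, \Gamma_2, \Phi_2)$ be minimal equicontinuous Cantor actions which are return equivalent. Then their relative asymptotic Steinitz orders agree: $$\Pi_a[\mathfrak{G}(\Phi_1):\mathfrak{D}(\Phi_1)] = \Pi_a[\mathfrak{G}(\Phi_2):\mathfrak{D}(\Phi_2)].$$ That is, the relative asymptotic Steinitz order $\Pi_a[\mathfrak{G}(\Phi):\mathfrak{D}(\Phi)]$ of a minimal equicontinuous Cantor action is an invariant of its return equivalence class.
   Context: A Cantor action $(\mathfrak{X}, \Gamma, \Phi)$ consists of a countable group $\Gamma$, a Cantor space $\mathfrak{X}$ and a minimal action $\Phi \colon \Gamma \times \mathfrak{X} \to \mathfrak{X}$ by homeomorphisms (every orbit is dense). It is equicontinuous if, for a metric $d_{\mathfrak{X}}$ compatible with the topology, for all $\varepsilon>0$ there is $\delta>0$ such that $d_{\mathfrak{X}}(x,y)<\delta$ implies $d_{\mathfrak{X}}(\gamma x,\gamma y)<\varepsilon$ for all $\gamma\in\Gamma$. For such an action, $\mathfrak{G}(\Phi) = \overline{\Phi(\Gamma)} \subset \mathrm{Homeo}(\mathfrak{X})$ denotes the closure in the uniform topology, a profinite group. For $x \in \mathfrak{X}$, $\mathfrak{D}(\Phi,x) = \{\widehat g \in \mathfrak{G}(\Phi) \mid \widehat g\, x = x\}$. A Steinitz number is a formal product $\prod_{p} p^{n(p)}$ over all primes, with $0 \leq n(p) \leq \infty$; multiplication adds exponents, and $LCM$ of a collection takes the supremum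 of exponents at each prime. Steinitz numbers $\Pi,\Pi'$ are asymptotically equivalent if there are integers $1\le m_0,n_0<\infty$ with $n_0\cdot\Pi = m_0\cdot\Pi'$. The relative Steinitz order is $\Pi[\mathfrak{G}(\Phi):\mathfrak{D}(\Phi)] = LCM\{\#\, \mathfrak{G}(\Phi)/(\mathfrak{N}\cdot\mathfrak{D}(\Phi,x)) \mid \mathfrak{N} \subset \mathfrak{G}(\Phi) \text{ open normal subgroup}\}$, for any choice of basepoint $x\in\mathfrak{X}$ (it does not depend on this choice), and $\Pi_a[\mathfrak{G}(\Phi):\mathfrak{D}(\Phi)]$ is its asymptotic equivalence class. A non-empty clopen set $U \subset \mathfrak{X}$ is adapted to the action if for every $g\in\Gamma$, $\Phi(g)(U)\cap U\neq\emptyset$ implies $\Phi(g)(U)=U$. Then $\Gamma_U = \{g\in\Gamma\mid \Phi(g)(U)\cap U \ne\emptyset\}$ is a subgroup of finite index; let $H_U\subset \mathrm{Homeo}(U)$ be the image of $\Gamma_U$ under restriction of the action to $U$, and let $(U,H_U,\Phi_U)$ be the resulting action. Actions $(\mathfrak{Y}_1,H_1,\Psi_1)$, $(\mathfrak{Y}_2,H_2,\Psi_2)$ are isomorphic if there are a homeomorphism $h\colon \mathfrak{Y}_1\to\mathfrak{Y}_2$ and a group isomorphism $\Theta\colon H_1\to H_2$ with $\Psi_1(g) = h^{-1}\circ\Psi_2(\Theta(g))\circ h$ for all $g\in H_1$. Two minimal equicontinuous Cantor actions $(\mathfrak{X}_i,\Gamma_i,\Phi_i)$, $i=1,2$, are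 return equivalent if there are adapted sets $U_i\subset\mathfrak{X}_i$ for $\Phi_i$ such that $(U_1,H_{1,U_1},\Phi_{1,U_1})$ and $(U_2,H_{2,U_2},\Phi_{2,U_2})$ are isomorphic. *)

theory Defs
  imports "HOL-Analysis.Analysis" "HOL-Algebra.Group_Action" "HOL-Algebra.Left_Coset"
    "HOL-Library.Extended_Nat" "HOL-Computational_Algebra.Primes"
begin

section \<open>Steinitz numbers\<close>

text \<open>The formal product of the \<open>p ^ n p\<close> over all primes is encoded by its exponent function \<open>n\<close>,
  extended by \<open>0\<close> to the non-primes.\<close>

typedef steinitz = "{n :: nat \<Rightarrow> enat. \<forall>p. \<not> prime p \<longrightarrow> n p = 0}"
  morphisms exponent Steinitz
  by (rule exI[of _ "\<lambda>_. 0"]) simp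

setup_lifting type_definition_steinitz

instantiation steinitz :: comm_monoid_mult
begin

lift_definition one_steinitz :: steinitz is "\<lambda>_. 0" by simp

lift_definition times_steinitz :: "steinitz \<Rightarrow> steinitz \<Rightarrow> steinitz"
  is "\<lambda>m n p. m p + n p" by simp

instance
  by standard (transfer; simp add: ac_simps fun_eq_iff)+

end

text \<open>Meaningful for \<open>n \<ge> 1\<close> only.\<close>

lift_definition steinitz_of_nat :: "nat \<Rightarrow> steinitz"
  is "\<lambda>n p. if prime p then enat (multiplicity p n) else 0" by simp

lift_definition steinitz_LCM :: "steinitz set \<Rightarrow> steinitz"
  is "\<lambda>S p. SUP n\<in>S. n p"
  by (auto simp: bot_enat_def[symmetric] intro!: SUP_bot_conv(1)[THEN iffD2])

definition asymp_equiv_steinitz :: "(steinitz \<times> steinitz) set" where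
  "asymp_equiv_steinitz = {(P, Q). \<exists>m n. 1 \<le> m \<and> 1 \<le> n \<and>
     steinitz_of_nat n * P = steinitz_of_nat m * Q}"

definition asymp_class :: "steinitz \<Rightarrow> steinitz set" where
  "asymp_class P = asymp_equiv_steinitz `` {P}"

lemma steinitz_of_nat_mult:
  assumes "1 \<le> m" "1 \<le> n"
  shows "steinitz_of_nat (m * n) = steinitz_of_nat m * steinitz_of_nat n"
proof -
  have "multiplicity p (m * n) = multiplicity p m + multiplicity p n" if "prime p" for p
    using that assms by (intro prime_elem_multiplicity_mult_distrib) auto
  then show ?thesis
    by transfer (auto simp: fun_eq_iff)
qed

lemma equiv_asymp_equiv_steinitz: "equiv UNIV asymp_equiv_steinitz"
proof (rule equivI)
  show "refl asymp_equiv_steinitz"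
    by (auto simp: refl_on_def asymp_equiv_steinitz_def)
  show "sym asymp_equiv_steinitz"
    by (rule symI) (auto simp: asymp_equiv_steinitz_def, metis)
  show "trans asymp_equiv_steinitz"
  proof (rule transI)
    fix P Q R
    assume "(P, Q) \<in> asymp_equiv_steinitz" "(Q, R) \<in> asymp_equiv_steinitz"
    then obtain m n m' n' :: nat where *: "1 \<le> m" "1 \<le> n" "1 \<le> m'" "1 \<le> n'"
      and 1: "steinitz_of_nat n * P = steinitz_of_nat m * Q"
      and 2: "steinitz_of_nat n' * Q = steinitz_of_nat m' * R"
      unfolding asymp_equiv_steinitz_def by blast
    have "steinitz_of_nat (n' * n) * P = steinitz_of_nat m * (steinitz_of_nat n' * Q)"
      using * 1 by (simp add: steinitz_of_nat_mult mult.assoc mult.left_commute)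
    also have "\<dots> = steinitz_of_nat m * (steinitz_of_nat m' * R)"
      by (simp only: 2)
    also have "\<dots> = steinitz_of_nat (m * m') * R"
      using * by (simp add: steinitz_of_nat_mult mult.assoc)
    finally show "(P, R) \<in> asymp_equiv_steinitz"
      unfolding asymp_equiv_steinitz_def using *
      by (intro CollectI case_prodI exI[of _ "m * m'"] exI[of _ "n' * n"]) simp
  qed
qed simp_all


section \<open>Equicontinuous Cantor actions\<close>

definition cantor_space :: "'x topology \<Rightarrow> bool" where
  "cantor_space X \<longleftrightarrow>
     X homeomorphic_space product_topology (\<lambda>_::nat. discrete_topology (UNIV :: bool set)) UNIV"

text \<open>As in \<^const>\<open>BijGroup\<close>, the elements are extensional functions.\<close>

definition homeo_group :: "'x topology \<Rightarrow> ('x \<Rightarrow> 'x) monoid" where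
  "homeo_group X =
     BijGroup (topspace X) \<lparr>carrier := {f \<in> Bij (topspace X). homeomorphic_map X X f}\<rparr>"

definition cantor_action ::
  "('g, 'm) monoid_scheme \<Rightarrow> 'x topology \<Rightarrow> ('g \<Rightarrow> 'x \<Rightarrow> 'x) \<Rightarrow> bool" where
  "cantor_action G X \<Phi> \<longleftrightarrow>
     countable (carrier G) \<and> cantor_space X \<and>
     group_action G (topspace X) \<Phi> \<and>
     (\<forall>g\<in>carrier G. homeomorphic_map X X (\<Phi> g)) \<and>
     (\<forall>x\<in>topspace X. X closure_of orbit G \<Phi> x = topspace X)"

definition equicontinuous ::
  "('g, 'm) monoid_scheme \<Rightarrow> 'x topology \<Rightarrow> ('g \<Rightarrow> 'x \<Rightarrow> 'x) \<Rightarrow> bool" where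
  "equicontinuous G X \<Phi> \<longleftrightarrow>
     (\<exists>d. mtopology_of d = X \<and>
       (\<forall>\<epsilon>>0. \<exists>\<delta>>0. \<forall>x\<in>topspace X. \<forall>y\<in>topspace X. mdist d x y < \<delta> \<longrightarrow>
          (\<forall>g\<in>carrier G. mdist d (\<Phi> g x) (\<Phi> g y) < \<epsilon>)))"

text \<open>The uniform topology is the topology of the supremum metric of a compatible metric \<open>d\<close>.
  For compact \<open>X\<close> it is the same for every choice of \<open>d\<close>; the choice is kept as a parameter.\<close>

definition uniform_topology :: "'x topology \<Rightarrow> 'x metric \<Rightarrow> ('x \<Rightarrow> 'x) topology" where
  "uniform_topology X d =
     subtopology (mtopology_of (cfunspace X d)) (carrier (homeo_group X))"

definition closure_group ::
  "('g, 'm) monoid_scheme \<Rightarrow> 'x topology \<Rightarrow> 'x metric \<Rightarrow> ('g \<Rightarrow> 'x \<Rightarrow> 'x) \<Rightarrow> ('x \<Rightarrow> 'x) monoid" where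
  "closure_group G X d \<Phi> =
     homeo_group X \<lparr>carrier := uniform_topology X d closure_of (\<Phi> ` carrier G)\<rparr>"

definition isotropy_group ::
  "('g, 'm) monoid_scheme \<Rightarrow> 'x topology \<Rightarrow> 'x metric \<Rightarrow> ('g \<Rightarrow> 'x \<Rightarrow> 'x) \<Rightarrow> 'x \<Rightarrow> ('x \<Rightarrow> 'x) set" where
  "isotropy_group G X d \<Phi> x = stabilizer (closure_group G X d \<Phi>) (\<lambda>g. g) x"

definition open_normal_subgroups ::
  "('g, 'm) monoid_scheme \<Rightarrow> 'x topology \<Rightarrow> 'x metric \<Rightarrow> ('g \<Rightarrow> 'x \<Rightarrow> 'x) \<Rightarrow> ('x \<Rightarrow> 'x) set set" where
  "open_normal_subgroups G X d \<Phi> =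
     {N. N \<lhd> closure_group G X d \<Phi> \<and>
         openin (subtopology (uniform_topology X d) (carrier (closure_group G X d \<Phi>))) N}"

text \<open>For an equicontinuous action on a Cantor space the closure group is compact, so the coset
  spaces below are finite and \<^const>\<open>card\<close> is their number of elements.\<close>

definition rel_steinitz_order ::
  "('g, 'm) monoid_scheme \<Rightarrow> 'x topology \<Rightarrow> 'x metric \<Rightarrow> ('g \<Rightarrow> 'x \<Rightarrow> 'x) \<Rightarrow> 'x \<Rightarrow> steinitz" where
  "rel_steinitz_order G X d \<Phi> x =
     (let K = closure_group G X d \<Phi> in
      steinitz_LCM ((\<lambda>N. steinitz_of_nat (card (lcosets\<^bsub>K\<^esub> (N <#>\<^bsub>K\<^esub> isotropy_group G X d \<Phi> x))))
        ` open_normal_subgroups G X d \<Phi>))"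

definition rel_asymp_steinitz_order ::
  "('g, 'm) monoid_scheme \<Rightarrow> 'x topology \<Rightarrow> 'x metric \<Rightarrow> ('g \<Rightarrow> 'x \<Rightarrow> 'x) \<Rightarrow> 'x \<Rightarrow> steinitz set" where
  "rel_asymp_steinitz_order G X d \<Phi> x = asymp_class (rel_steinitz_order G X d \<Phi> x)"


section \<open>Return equivalence\<close>

definition adapted ::
  "('g, 'm) monoid_scheme \<Rightarrow> 'x topology \<Rightarrow> ('g \<Rightarrow> 'x \<Rightarrow> 'x) \<Rightarrow> 'x set \<Rightarrow> bool" where
  "adapted G X \<Phi> U \<longleftrightarrow>
     U \<noteq> {} \<and> openin X U \<and> closedin X U \<and>
     (\<forall>g\<in>carrier G. \<Phi> g ` U \<inter> U \<noteq> {} \<longrightarrow> \<Phi> g ` U = U)"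

definition return_set ::
  "('g, 'm) monoid_scheme \<Rightarrow> ('g \<Rightarrow> 'x \<Rightarrow> 'x) \<Rightarrow> 'x set \<Rightarrow> 'g set" where
  "return_set G \<Phi> U = {g \<in> carrier G. \<Phi> g ` U \<inter> U \<noteq> {}}"

definition holonomy_group ::
  "('g, 'm) monoid_scheme \<Rightarrow> 'x topology \<Rightarrow> ('g \<Rightarrow> 'x \<Rightarrow> 'x) \<Rightarrow> 'x set \<Rightarrow> ('x \<Rightarrow> 'x) monoid" where
  "holonomy_group G X \<Phi> U =
     homeo_group (subtopology X U) \<lparr>carrier := (\<lambda>g. restrict (\<Phi> g) U) ` return_set G \<Phi> U\<rparr>"

definition isomorphic_actions ::
  "('g, 'm) monoid_scheme \<Rightarrow> 'x topology \<Rightarrow> ('g \<Rightarrow> 'x \<Rightarrow> 'x) \<Rightarrow>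
   ('h, 'n) monoid_scheme \<Rightarrow> 'y topology \<Rightarrow> ('h \<Rightarrow> 'y \<Rightarrow> 'y) \<Rightarrow> bool" where
  "isomorphic_actions H1 Y1 \<Psi>1 H2 Y2 \<Psi>2 \<longleftrightarrow>
     (\<exists>h h' \<Theta>. homeomorphic_maps Y1 Y2 h h' \<and> \<Theta> \<in> iso H1 H2 \<and>
        (\<forall>g\<in>carrier H1. \<forall>y\<in>topspace Y1. \<Psi>1 g y = h' (\<Psi>2 (\<Theta> g) (h y))))"

text \<open>The elements of \<^const>\<open>holonomy_group\<close> are homeomorphisms of \<open>U\<close>, acting by evaluation.\<close>

definition return_equivalent ::
  "('g, 'm) monoid_scheme \<Rightarrow> 'x topology \<Rightarrow> ('g \<Rightarrow> 'x \<Rightarrow> 'x) \<Rightarrow>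
   ('h, 'n) monoid_scheme \<Rightarrow> 'y topology \<Rightarrow> ('h \<Rightarrow> 'y \<Rightarrow> 'y) \<Rightarrow> bool" where
  "return_equivalent G1 X1 \<Phi>1 G2 X2 \<Phi>2 \<longleftrightarrow>
     (\<exists>U1 U2. adapted G1 X1 \<Phi>1 U1 \<and> adapted G2 X2 \<Phi>2 U2 \<and>
        isomorphic_actions
          (holonomy_group G1 X1 \<Phi>1 U1) (subtopology X1 U1) (\<lambda>g. g)
          (holonomy_group G2 X2 \<Phi>2 U2) (subtopology X2 U2) (\<lambda>g. g))"

end

theory Submission
  imports Defs
begin

text \<open>Writing \<open>i W\<close> for the number of translates of an adapted set \<open>W\<close>, the relative Steinitz order is
  the least common multiple of all \<open>i W\<close>. Indeed, if \<open>N\<close> is an open normal subgroup of the closure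
  group, then the cosets of \<open>N \<cdot> D\<close> correspond to the translates of the orbit \<open>N x\<close>, which is clopen
  by compactness and hence adapted; conversely, the elements fixing every translate of \<open>W\<close> form an
  open normal subgroup whose orbits lie inside the translates of \<open>W\<close>. If \<open>V\<close> and \<open>U\<close> are adapted and
  \<open>V \<subseteq> U\<close>, then \<open>i V = i U \<cdot> j V\<close>, where \<open>j V\<close> is the number of translates of \<open>V\<close> inside \<open>U\<close>, which
  is computed by the holonomy group of \<open>U\<close> alone. So the order of the whole action is \<open>i U\<close> times an
  isomorphism invariant of the restricted action.\<close>


section \<open>Blocks of transformation groups\<close>

text \<open>The orders are defined through a closure group in a metric topology, while return
  equivalence speaks of the acting groups on clopen sets. The two sides meet in
  \<open>steinitz_index\<close>, which is defined for an arbitrary set of maps: the closure is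
  compared with it once, on each whole space, and the passage to \<open>U\<close> and along the
  homeomorphism is then a matter of blocks and counting, with no closure formed for the return maps.
  The isotropy group disappears because \<open>N \<cdot> D\<close> is the set of elements that send
  the base point into its \<open>N\<close>-orbit. The metric is eliminated by recording only into
  which translate of an adapted set each point is sent. Compactness comes from the product topology
  on all self-maps, together with the finiteness of the number of such records for each adapted
  set.\<close>

definition translates :: "('x \<Rightarrow> 'x) set \<Rightarrow> 'x set \<Rightarrow> 'x set set" where
  "translates A W = (\<lambda>f. f ` W) ` A"

text \<open>A block of imprimitivity. It is defined for a bare set of maps so that it applies both
  to the acting group on \<open>X\<close> and to the return maps on \<open>U\<close>.\<close>

definition block :: "('x \<Rightarrow> 'x) set \<Rightarrow> 'x set \<Rightarrow> bool" where
  "block A W \<longleftrightarrow> (\<forall>f\<in>A. f ` W \<inter> W \<noteq> {} \<longrightarrow> f ` W = W)"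

lemma image_identI: "(\<And>x. x \<in> W \<Longrightarrow> f x = x) \<Longrightarrow> f ` W = W"
  using image_cong[OF refl, of W f "\<lambda>x. x"] by simp

lemma blockD: "block A W \<Longrightarrow> f \<in> A \<Longrightarrow> f x \<in> W \<Longrightarrow> x \<in> W \<Longrightarrow> f ` W = W"
  unfolding block_def by blast

locale transformation_group =
  fixes S :: "'x set" and A :: "('x \<Rightarrow> 'x) set"
  assumes subgroup_Bij: "subgroup A (BijGroup S)"
begin

lemma subset_Bij: "A \<subseteq> Bij S"
  using subgroup.subset[OF subgroup_Bij] by (simp add: BijGroup_def)

lemma bij: "f \<in> A \<Longrightarrow> bij_betw f S S"
  using subset_Bij by (auto simp: Bij_def)

lemma maps_to: "f \<in> A \<Longrightarrow> x \<in> S \<Longrightarrow> f x \<in> S"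
  using bij by (blast dest: bij_betwE)

lemma inj: "f \<in> A \<Longrightarrow> x \<in> S \<Longrightarrow> y \<in> S \<Longrightarrow> f x = f y \<longleftrightarrow> x = y"
  using bij by (metis bij_betw_def inj_on_eq_iff)

lemma ext_on: "f \<in> A \<Longrightarrow> f \<in> extensional S"
  using subset_Bij by (auto simp: Bij_def)

lemma compose_closed: "f \<in> A \<Longrightarrow> g \<in> A \<Longrightarrow> compose S f g \<in> A"
  using subgroup.m_closed[OF subgroup_Bij, of f g] subset_Bij
  by (auto simp: BijGroup_def subset_eq)

text \<open>Together with \<open>one_ex\<close> and \<open>inverse_ex\<close> this gives the group
  operations as equations at points of \<open>S\<close>, which keeps restrictions and extensionality
  out of most later arguments.\<close>

lemma compose_ex:
  assumes "f \<in> A" "g \<in> A"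
  obtains h where "h \<in> A" "\<And>x. x \<in> S \<Longrightarrow> h x = f (g x)"
  using compose_closed[OF assms] by (auto simp: compose_def)

lemma one_ex: obtains e where "e \<in> A" "\<And>x. x \<in> S \<Longrightarrow> e x = x"
  using subgroup.one_closed[OF subgroup_Bij] by (auto simp: BijGroup_def)

lemma inverse_ex:
  assumes "f \<in> A"
  obtains h where "h \<in> A" "\<And>x. x \<in> S \<Longrightarrow> h (f x) = x" "\<And>x. x \<in> S \<Longrightarrow> f (h x) = x"
proof -
  interpret group "BijGroup S" by (rule group_BijGroup)
  let ?h = "inv\<^bsub>BijGroup S\<^esub> f"
  have h: "?h \<in> A"
    using subgroup.m_inv_closed[OF subgroup_Bij assms] .
  have c: "f \<in> carrier (BijGroup S)" "?h \<in> carrier (BijGroup S)"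
    using h assms subset_Bij by (auto simp: BijGroup_def)
  have 1: "compose S ?h f = (\<lambda>x\<in>S. x)" "compose S f ?h = (\<lambda>x\<in>S. x)"
    using l_inv[OF c(1)] r_inv[OF c(1)] c by (auto simp: BijGroup_def)
  show ?thesis
    by (rule that[OF h]; metis 1 compose_eq restrict_apply')
qed

lemma translates_self: "W \<subseteq> S \<Longrightarrow> W \<in> translates A W"
proof -
  assume W: "W \<subseteq> S"
  obtain e where "e \<in> A" "\<And>x. x \<in> S \<Longrightarrow> e x = x" using one_ex by blast
  then show ?thesis
    unfolding translates_def using W by (intro image_eqI[of _ _ e] image_identI[symmetric]) auto
qed

lemma translates_image:
  assumes "W \<subseteq> S" "f \<in> A" "B \<in> translates A W"
  shows "f ` B \<in> translates A W"
proof -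
  obtain g where g: "g \<in> A" "B = g ` W" using assms by (auto simp: translates_def)
  obtain h where h: "h \<in> A" "\<And>x. x \<in> S \<Longrightarrow> h x = f (g x)"
    using compose_ex[OF assms(2) g(1)] by blast
  then have "f ` B = h ` W"
    using g assms(1) by (auto simp: image_image subset_eq intro!: image_cong)
  with h show ?thesis by (auto simp: translates_def)
qed

lemma translates_subset: "W \<subseteq> S \<Longrightarrow> B \<in> translates A W \<Longrightarrow> B \<subseteq> S"
  using maps_to by (auto simp: translates_def)

text \<open>If \<open>f u = g v\<close>, then \<open>k\<close>, which is \<open>g\<close> followed
  by the inverse of \<open>f\<close>, sends \<open>v\<close> to \<open>u\<close> within
  \<open>W\<close>. Hence \<open>k\<close> preserves \<open>W\<close>, and applying \<open>f\<close>
  shows that the two images of \<open>W\<close> agree.\<close>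

lemma translates_disjoint:
  assumes W: "W \<subseteq> S" "block A W" and BC: "B \<in> translates A W" "C \<in> translates A W"
    and x: "x \<in> B" "x \<in> C"
  shows "B = C"
proof -
  obtain f g where f: "f \<in> A" "B = f ` W" and g: "g \<in> A" "C = g ` W"
    using BC by (auto simp: translates_def)
  obtain h where h: "h \<in> A" "\<And>x. x \<in> S \<Longrightarrow> h (f x) = x" "\<And>x. x \<in> S \<Longrightarrow> f (h x) = x"
    using inverse_ex[OF f(1)] by blast
  obtain k where k: "k \<in> A" "\<And>x. x \<in> S \<Longrightarrow> k x = h (g x)"
    using compose_ex[OF h(1) g(1)] by blast
  obtain u v where uv: "u \<in> W" "v \<in> W" "f u = g v" using x f g by blast
  have "k v = u" using uv k h W by (metis subsetD)
  then have kW: "k ` W = W" using blockD[OF W(2) k(1)] uv by blast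
  have "f (k w) = g w" if "w \<in> W" for w
    using that k h g W by (metis maps_to subsetD)
  then have "f ` (k ` W) = g ` W" by (simp add: image_image cong: image_cong_simp)
  with kW f g show ?thesis by simp
qed

lemma block_translate:
  assumes "W \<subseteq> S" "block A W" "B \<in> translates A W"
  shows "block A B"
  unfolding block_def
  using translates_disjoint[OF assms(1,2) translates_image[OF assms(1) _ assms(3)] assms(3)]
  by blast

text \<open>Allows \<open>W\<close> to be replaced by whichever translate contains a given point,
  without changing the number of translates.\<close>

lemma translates_translate:
  assumes W: "W \<subseteq> S" and B: "B \<in> translates A W"
  shows "translates A B = translates A W"
proof
  show "translates A B \<subseteq> translates A W"
    using translates_image[OF W _ B] by (auto simp: translates_def)
  obtain f where f: "f \<in> A" "B = f ` W" using B by (auto simp: translates_def)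
  obtain h where h: "h \<in> A" "\<And>x. x \<in> S \<Longrightarrow> h (f x) = x" "\<And>x. x \<in> S \<Longrightarrow> f (h x) = x"
    using inverse_ex[OF f(1)] by blast
  have "h ` B = W" using f h W by (auto simp: image_image intro!: image_identI)
  then have "W \<in> translates A B" using h by (auto simp: translates_def)
  moreover have "B \<subseteq> S" using translates_subset[OF W B] .
  ultimately show "translates A W \<subseteq> translates A B"
    using translates_image[of B _ W] by (auto simp: translates_def[of A W])
qed

text \<open>Every translate of \<open>V\<close> lies in exactly one translate of \<open>W\<close>,
  and an element of \<open>A\<close> carrying \<open>W\<close> to another translate matches the
  translates of \<open>V\<close> inside the two. This is the multiplicativity of the index along a
  chain of stabilizers, in terms of blocks.\<close>

lemma card_translates_mult:
  assumes W: "W \<subseteq> S" "block A W" and V: "V \<subseteq> W" "V \<noteq> {}" "block A V"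
    and fin: "finite (translates A V)"
  shows "card (translates A V) = card (translates A W) * card {B \<in> translates A V. B \<subseteq> W}"
proof -
  define F where "F C = {B \<in> translates A V. B \<subseteq> C}" for C
  have VS: "V \<subseteq> S" using V W by blast
  have ne: "B \<noteq> {}" if "B \<in> translates A V" for B
    using that V by (auto simp: translates_def)
  have inF: "f ` B \<in> F (f ` C)" if "f \<in> A" "B \<in> F C" for f B C
    using that translates_image[OF VS] by (auto simp: F_def)
  have VF: "V \<in> F W" using V translates_self[OF VS] by (simp add: F_def)
  have un: "\<Union>(F ` translates A W) = translates A V"
  proof
    show "translates A V \<subseteq> \<Union>(F ` translates A W)"
      using inF[OF _ VF] by (auto simp: translates_def)
  qed (auto simp: F_def)
  have disj: "C = D" if "C \<in> translates A W" "D \<in> translates A W" "B \<in> F C" "B \<in> F D" for B C D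
  proof -
    have "B \<noteq> {}" "B \<subseteq> C" "B \<subseteq> D" using ne that(3,4) by (auto simp: F_def)
    then obtain y where "y \<in> C" "y \<in> D" by blast
    then show ?thesis using translates_disjoint[OF W that(1,2)] by blast
  qed
  have card: "card (F C) = card (F W)" if C: "C \<in> translates A W" for C
  proof -
    obtain f where f: "f \<in> A" "C = f ` W" using C by (auto simp: translates_def)
    obtain h where h: "h \<in> A" "\<And>x. x \<in> S \<Longrightarrow> h (f x) = x" "\<And>x. x \<in> S \<Longrightarrow> f (h x) = x"
      using inverse_ex[OF f(1)] by blast
    have hC: "h ` C = W" using f h W by (auto simp: image_image intro!: image_identI)
    have hf: "h ` f ` B = B" "f ` h ` B = B" if "B \<subseteq> S" for B
      using that h by (auto simp: image_image intro!: image_identI)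
    have sub: "B \<subseteq> S" if "B \<in> F D" for B D
      using that translates_subset[OF VS] by (simp add: F_def)
    have "bij_betw ((`) f) (F W) (F C)"
    proof (rule bij_betw_byWitness[where f' = "(`) h"])
      show "\<forall>B\<in>F W. h ` f ` B = B" "\<forall>B\<in>F C. f ` h ` B = B"
        using hf[OF sub] by simp_all
      show "(`) f ` F W \<subseteq> F C" unfolding f(2) by (rule image_subsetI) (rule inF[OF f(1)])
      show "(`) h ` F C \<subseteq> F W"
        by (rule image_subsetI) (rule inF[OF h(1), of _ C, unfolded hC])
    qed
    then show ?thesis by (simp add: bij_betw_same_card)
  qed
  \<comment> \<open>\<open>F C\<close> is never empty for a translate \<open>C\<close>, so distinct
    translates of \<open>W\<close> have distinct fibres, and counting fibres counts
    translates.\<close>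
  have inj: "inj_on F (translates A W)"
  proof (rule inj_onI)
    fix C D assume CD: "C \<in> translates A W" "D \<in> translates A W" "F C = F D"
    obtain f where f: "f \<in> A" "C = f ` W" using CD by (auto simp: translates_def)
    have "f ` V \<in> F C" using inF[OF f(1) VF] f(2) by simp
    with CD(3) show "C = D" using disj[OF CD(1,2)] by simp
  qed
  have "card (F W) * card (F ` translates A W) = card (\<Union>(F ` translates A W))"
  proof (rule card_partition)
    show "finite (F ` translates A W)"
      by (rule finite_subset[of _ "Pow (translates A V)"]) (use fin in \<open>auto simp: F_def\<close>)
    show "finite (\<Union>(F ` translates A W))" using un fin by simp
    show "\<And>c. c \<in> F ` translates A W \<Longrightarrow> card c = card (F W)" using card by auto
    show "\<And>c1 c2. c1 \<in> F ` translates A W \<Longrightarrow> c2 \<in> F ` translates A W \<Longrightarrow> c1 \<noteq> c2 \<Longrightarrow> c1 \<inter> c2 = {}"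
      using disj by blast
  qed
  then show ?thesis
    unfolding un card_image[OF inj] by (simp add: F_def mult.commute)
qed

section \<open>Normal subgroups: their orbits and the cosets of their product with the isotropy
  group\<close>

text \<open>Equality of left and right cosets of \<open>N\<close>, read at points: \<open>f\<close>
  moves past \<open>n\<close> at the cost of changing \<open>n\<close>.\<close>

lemma normal_commute:
  assumes N: "N \<lhd> (BijGroup S)\<lparr>carrier := A\<rparr>" and f: "f \<in> A" and n: "n \<in> N"
  obtains m where "m \<in> N" "\<And>y. y \<in> S \<Longrightarrow> f (n y) = m (f y)"
proof -
  let ?K = "(BijGroup S)\<lparr>carrier := A\<rparr>"
  interpret N: normal N ?K by (rule N)
  have NA: "N \<subseteq> A" using N.subset by simp
  have mult: "g \<otimes>\<^bsub>?K\<^esub> h = compose S g h" if "g \<in> A" "h \<in> A" for g h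
    using that subset_Bij by (auto simp: BijGroup_def subset_eq)
  have "f \<otimes>\<^bsub>?K\<^esub> n \<in> f <#\<^bsub>?K\<^esub> N" using n by (auto simp: l_coset_def)
  then have "f \<otimes>\<^bsub>?K\<^esub> n \<in> N #>\<^bsub>?K\<^esub> f" using N.coset_eq f by simp
  then obtain m where m: "m \<in> N" "f \<otimes>\<^bsub>?K\<^esub> n = m \<otimes>\<^bsub>?K\<^esub> f" by (auto simp: r_coset_def)
  then have "compose S f n = compose S m f" using mult f n NA by (metis subsetD)
  then show ?thesis using that m(1) by (metis compose_eq)
qed

lemma subgroup_transformation_group:
  assumes "subgroup N ((BijGroup S)\<lparr>carrier := A\<rparr>)"
  shows "transformation_group S N"
  using group.incl_subgroup[OF group_BijGroup subgroup_Bij assms] by (rule transformation_group.intro)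

text \<open>By normality \<open>f\<close> sends the \<open>N\<close>-orbit of \<open>x\<close> to
  the \<open>N\<close>-orbit of \<open>f x\<close>, and two orbits of \<open>N\<close> that meet are
  equal.\<close>

lemma block_normal_orbit:
  assumes N: "N \<lhd> (BijGroup S)\<lparr>carrier := A\<rparr>" and x: "x \<in> S"
  shows "block A ((\<lambda>n. n x) ` N)"
proof -
  let ?V = "(\<lambda>n. n x) ` N"
  interpret N: transformation_group S N
    using subgroup_transformation_group normal_imp_subgroup N by blast
  have NA: "N \<subseteq> A" using normal_imp_subgroup[OF N] subgroup.subset by fastforce
  have sub: "f ` ?V \<subseteq> ?V" if f: "f \<in> A" and hit: "f ` ?V \<inter> ?V \<noteq> {}" for f
  proof -
    from hit obtain n m where nm: "n \<in> N" "m \<in> N" "f (n x) = m x" by auto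
    obtain n' where n': "n' \<in> N" "\<And>y. y \<in> S \<Longrightarrow> f (n y) = n' (f y)"
      using normal_commute[OF N f nm(1)] by blast
    obtain n'' where n'': "n'' \<in> N" "\<And>y. y \<in> S \<Longrightarrow> n'' (n' y) = y"
      by (rule N.inverse_ex[OF n'(1)]) blast
    \<comment> \<open>The assumed common point puts \<open>f x\<close> itself in the
      \<open>N\<close>-orbit of \<open>x\<close>.\<close>
    have fx: "f x = n'' (m x)"
      using n'(2)[OF x] n''(2)[OF maps_to[OF f x]] nm(3) by simp
    show ?thesis
    proof clarify
      fix a assume "a \<in> N"
      then obtain a' where a': "a' \<in> N" "\<And>y. y \<in> S \<Longrightarrow> f (a y) = a' (f y)"
        by (rule normal_commute[OF N f]) blast
      obtain q where q: "q \<in> N" "\<And>y. y \<in> S \<Longrightarrow> q y = n'' (m y)"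
        by (rule N.compose_ex[OF n''(1) nm(2)]) blast
      obtain r where r: "r \<in> N" "\<And>y. y \<in> S \<Longrightarrow> r y = a' (q y)"
        by (rule N.compose_ex[OF a'(1) q(1)]) blast
      have "f (a x) = r x" using a' q r fx x by simp
      then show "f (a x) \<in> ?V" using r by blast
    qed
  qed
  have VS: "?V \<subseteq> S" using N.maps_to x by blast
  show ?thesis
    unfolding block_def
  proof (intro ballI impI)
    fix f assume f: "f \<in> A" and hit: "f ` ?V \<inter> ?V \<noteq> {}"
    obtain h where h: "h \<in> A" "\<And>x. x \<in> S \<Longrightarrow> h (f x) = x" "\<And>x. x \<in> S \<Longrightarrow> f (h x) = x"
      using inverse_ex[OF f] by blast
    \<comment> \<open>The inverse \<open>h\<close> also moves the orbit so that it meets itself; the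
      inclusion \<open>sub\<close> for \<open>h\<close> is the missing reverse inclusion.\<close>
    obtain v where v: "v \<in> ?V" "f v \<in> ?V" using hit by blast
    have "h (f v) = v" using v VS h by blast
    then have "h ` ?V \<inter> ?V \<noteq> {}" using v by (metis disjoint_iff image_eqI)
    then have "h ` ?V \<subseteq> ?V" using sub h by blast
    then have "f ` h ` ?V \<subseteq> f ` ?V" by (rule image_mono)
    moreover have "f ` h ` ?V = ?V"
      unfolding image_image[of f] by (rule image_identI) (use h VS in blast)
    ultimately show "f ` ?V = ?V" using sub[OF f hit] by simp
  qed
qed

text \<open>The isotropy group absorbs everything that the value at \<open>x\<close> does not see:
  the coset of \<open>a\<close> consists of all \<open>k\<close> in \<open>A\<close> with
  \<open>k x\<close> in the image under \<open>a\<close> of the \<open>N\<close>-orbit. Evaluation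
  at \<open>x\<close> thus matches cosets with translates of that orbit.\<close>

lemma card_lcosets:
  assumes N: "N \<lhd> (BijGroup S)\<lparr>carrier := A\<rparr>" and x: "x \<in> S"
  defines "K \<equiv> (BijGroup S)\<lparr>carrier := A\<rparr>"
  shows "card (lcosets\<^bsub>K\<^esub> (N <#>\<^bsub>K\<^esub> stabilizer K (\<lambda>g. g) x)) = card (translates A ((\<lambda>n. n x) ` N))"
proof -
  let ?V = "(\<lambda>n. n x) ` N" and ?D = "stabilizer K (\<lambda>g. g) x"
  have NA: "N \<subseteq> A" using normal_imp_subgroup[OF N] subgroup.subset by fastforce
  have mult: "f \<otimes>\<^bsub>K\<^esub> g = compose S f g" if "f \<in> A" "g \<in> A" for f g
    using that subset_Bij by (auto simp: K_def BijGroup_def subset_eq)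
  have D: "k \<in> ?D \<longleftrightarrow> k \<in> A \<and> k x = x" for k by (auto simp: stabilizer_def K_def)
  define \<phi> where "\<phi> B = {k \<in> A. k x \<in> B}" for B
  have coset: "a <#\<^bsub>K\<^esub> (N <#>\<^bsub>K\<^esub> ?D) = \<phi> (a ` ?V)" if a: "a \<in> A" for a
  proof (rule Set.set_eqI, rule iffI)
    fix k assume "k \<in> a <#\<^bsub>K\<^esub> (N <#>\<^bsub>K\<^esub> ?D)"
    then obtain n d where nd: "n \<in> N" "d \<in> ?D" "k = a \<otimes>\<^bsub>K\<^esub> (n \<otimes>\<^bsub>K\<^esub> d)"
      by (auto simp: l_coset_def set_mult_def)
    then have "k = compose S a (compose S n d)" "n \<in> A" "d \<in> A" "d x = x"
      using NA D mult compose_closed a by (simp_all add: subsetD)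
    then show "k \<in> \<phi> (a ` ?V)"
      using nd x a compose_closed by (auto simp: \<phi>_def compose_eq)
  next
    fix k assume "k \<in> \<phi> (a ` ?V)"
    then obtain n where k: "k \<in> A" "n \<in> N" "k x = a (n x)" by (auto simp: \<phi>_def)
    have n: "n \<in> A" using k NA by auto
    \<comment> \<open>\<open>p\<close> is \<open>a\<close> after \<open>n\<close>, and
      \<open>q\<close> is its inverse; since \<open>k x = p x\<close>, the map \<open>q\<close>
      after \<open>k\<close> fixes \<open>x\<close> and is the required isotropy factor.\<close>
    obtain p where p: "p \<in> A" "\<And>y. y \<in> S \<Longrightarrow> p y = a (n y)"
      using compose_ex[OF a n] by blast
    obtain q where q: "q \<in> A" "\<And>y. y \<in> S \<Longrightarrow> q (p y) = y" "\<And>y. y \<in> S \<Longrightarrow> p (q y) = y"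
      using inverse_ex[OF p(1)] by blast
    let ?d = "compose S q k"
    have d: "?d \<in> A" using compose_closed q k by blast
    have "?d x = x" using x k p q by (metis compose_eq)
    then have "?d \<in> ?D" using d D by blast
    moreover have "k = compose S a (compose S n ?d)"
    proof (rule extensionalityI[OF ext_on[OF k(1)]])
      show "compose S a (compose S n ?d) \<in> extensional S" by simp
      fix y assume y: "y \<in> S"
      have "q (k y) \<in> S" using q k y maps_to by blast
      then show "k y = compose S a (compose S n ?d) y"
        using y p q k by (metis compose_eq maps_to)
    qed
    then have "k = a \<otimes>\<^bsub>K\<^esub> (n \<otimes>\<^bsub>K\<^esub> ?d)"
      using mult a n d compose_closed by metis
    ultimately show "k \<in> a <#\<^bsub>K\<^esub> (N <#>\<^bsub>K\<^esub> ?D)"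
      using k by (auto simp: l_coset_def set_mult_def)
  qed
  have "lcosets\<^bsub>K\<^esub> (N <#>\<^bsub>K\<^esub> ?D) = \<phi> ` translates A ?V"
    using coset by (auto simp: LCOSETS_def K_def translates_def)
  \<comment> \<open>Evaluating all members of \<open>\<phi> B\<close> at \<open>x\<close> gives back
    \<open>B\<close>.\<close>
  moreover have "inj_on \<phi> (translates A ?V)"
  proof (rule inj_on_inverseI[where g = "\<lambda>C. (\<lambda>k. k x) ` C"])
    fix B assume "B \<in> translates A ?V"
    then obtain a where a: "a \<in> A" "B = a ` ?V" by (auto simp: translates_def)
    have "y \<in> (\<lambda>k. k x) ` \<phi> B" if "y \<in> B" for y
    proof -
      obtain n where n: "n \<in> N" "y = a (n x)" using \<open>y \<in> B\<close> a(2) by blast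
      obtain p where p: "p \<in> A" "\<And>y. y \<in> S \<Longrightarrow> p y = a (n y)"
        using compose_ex[OF a(1), of n] n NA by blast
      then show ?thesis using that n x by (auto simp: \<phi>_def image_iff)
    qed
    then show "(\<lambda>k. k x) ` \<phi> B = B" by (auto simp: \<phi>_def)
  qed
  ultimately show ?thesis by (simp add: card_image)
qed

end


section \<open>Adapted sets of equicontinuous actions\<close>

definition adapted_sets :: "'x topology \<Rightarrow> ('x \<Rightarrow> 'x) set \<Rightarrow> 'x set set" where
  "adapted_sets X A = {W. W \<noteq> {} \<and> openin X W \<and> closedin X W \<and> block A W}"

text \<open>Neither a closure nor a base point nor a metric enters, so the same formula makes sense
  for the return maps on an adapted set.\<close>

definition steinitz_index :: "'x topology \<Rightarrow> ('x \<Rightarrow> 'x) set \<Rightarrow> steinitz" where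
  "steinitz_index X A =
     steinitz_LCM ((\<lambda>W. steinitz_of_nat (card (translates A W))) ` adapted_sets X A)"

text \<open>The properties of an equicontinuous Cantor action freed of the metric: equicontinuity
  becomes local constancy, uniform in \<open>f\<close>, of the condition \<open>f y \<in> C\<close>
  for clopen \<open>C\<close>. The group is represented by its image \<open>A\<close>.\<close>

locale equicontinuous_system = transformation_group "topspace X" A
  for X :: "'x topology" and A :: "('x \<Rightarrow> 'x) set" +
  assumes nonempty: "topspace X \<noteq> {}"
    and compact: "compact_space X"
    and Hausdorff: "Hausdorff_space X"
    and clopen_base: "openin X V \<Longrightarrow> x \<in> V \<Longrightarrow> \<exists>C. openin X C \<and> closedin X C \<and> x \<in> C \<and> C \<subseteq> V"
    and continuous: "f \<in> A \<Longrightarrow> continuous_map X X f"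
    and minimal: "openin X V \<Longrightarrow> V \<noteq> {} \<Longrightarrow> x \<in> topspace X \<Longrightarrow> \<exists>f\<in>A. f x \<in> V"
    and equicontinuous: "openin X C \<Longrightarrow> closedin X C \<Longrightarrow> x \<in> topspace X \<Longrightarrow>
      \<exists>V. openin X V \<and> x \<in> V \<and> (\<forall>y\<in>V. \<forall>f\<in>A. f y \<in> C \<longleftrightarrow> f x \<in> C)"
begin

abbreviation "S \<equiv> topspace X"

lemma adaptedD:
  assumes "W \<in> adapted_sets X A"
  shows "W \<noteq> {}" "openin X W" "closedin X W" "block A W" "W \<subseteq> S"
  using assms openin_subset by (auto simp: adapted_sets_def)

lemma image_eq_preimage:
  assumes f: "f \<in> A" and h: "\<And>x. x \<in> S \<Longrightarrow> h (f x) = x" "\<And>x. x \<in> S \<Longrightarrow> f (h x) = x"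
    and W: "W \<subseteq> S"
  shows "f ` W = {x \<in> S. h x \<in> W}"
proof (intro subset_antisym subsetI)
  fix x assume "x \<in> f ` W"
  then obtain w where "w \<in> W" "x = f w" by blast
  then show "x \<in> {x \<in> S. h x \<in> W}" using W h(1)[of w] maps_to[OF f, of w] by auto
next
  fix x assume "x \<in> {x \<in> S. h x \<in> W}"
  then have "h x \<in> W" "f (h x) = x" using h(2)[of x] by auto
  then show "x \<in> f ` W" by (metis image_eqI)
qed

lemma adapted_translate:
  assumes W: "W \<in> adapted_sets X A" and B: "B \<in> translates A W"
  shows "B \<in> adapted_sets X A"
proof -
  note W' = adaptedD[OF W]
  obtain f where f: "f \<in> A" "B = f ` W" using B by (auto simp: translates_def)
  obtain h where h: "h \<in> A" "\<And>x. x \<in> S \<Longrightarrow> h (f x) = x" "\<And>x. x \<in> S \<Longrightarrow> f (h x) = x"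
    by (rule inverse_ex[OF f(1)]) blast
  have B_eq: "B = {x \<in> S. h x \<in> W}"
    unfolding f(2) by (rule image_eq_preimage[OF f(1) h(2,3) W'(5)])
  have "openin X B" "closedin X B"
    unfolding B_eq using W' openin_continuous_map_preimage[OF continuous[OF h(1)]]
      closedin_continuous_map_preimage[OF continuous[OF h(1)]] by auto
  then show ?thesis
    using block_translate[OF W'(5,4) B] f W' by (auto simp: adapted_sets_def)
qed

lemma Union_translates:
  assumes W: "W \<in> adapted_sets X A"
  shows "\<Union>(translates A W) = S"
proof
  show "\<Union>(translates A W) \<subseteq> S"
    using translates_subset[OF adaptedD(5)[OF W]] by blast
  show "S \<subseteq> \<Union>(translates A W)"
  proof
    fix x assume x: "x \<in> S"
    obtain f where f: "f \<in> A" "f x \<in> W"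
      using minimal[OF adaptedD(2,1)[OF W] x] by blast
    obtain h where h: "h \<in> A" "\<And>x. x \<in> S \<Longrightarrow> h (f x) = x"
      by (rule inverse_ex[OF f(1)]) blast
    then have "x \<in> h ` W" using f x by (metis image_eqI)
    then show "x \<in> \<Union>(translates A W)" using h(1) by (auto simp: translates_def)
  qed
qed

lemma translates_cover:
  assumes "W \<in> adapted_sets X A" "x \<in> S"
  obtains B where "B \<in> translates A W" "x \<in> B"
  using Union_translates[OF assms(1)] assms(2) by blast

text \<open>The translates partition a compact space into non-empty open sets, so a finite subcover
  cannot omit any of them.\<close>

lemma finite_translates:
  assumes W: "W \<in> adapted_sets X A"
  shows "finite (translates A W)"
proof -
  have "\<forall>U\<in>translates A W. openin X U" using adapted_translate[OF W] adaptedD by blast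
  then obtain F where F: "finite F" "F \<subseteq> translates A W" "S \<subseteq> \<Union>F"
    using compact Union_translates[OF W] unfolding compact_space_alt by (metis order_refl)
  have "B \<in> F" if B: "B \<in> translates A W" for B
  proof -
    obtain x where x: "x \<in> B" using adaptedD(1)[OF adapted_translate[OF W B]] by blast
    then have "x \<in> S" using translates_subset[OF adaptedD(5)[OF W] B] by blast
    then obtain C where "C \<in> F" "x \<in> C" using F by blast
    then show ?thesis using translates_disjoint[OF adaptedD(5,4)[OF W] B] x F by blast
  qed
  then have "translates A W \<subseteq> F" by blast
  then show ?thesis by (rule finite_subset) (rule F(1))
qed

lemma card_translates_pos: "W \<in> adapted_sets X A \<Longrightarrow> card (translates A W) > 0"
  using finite_translates[of W] translates_self[OF adaptedD(5)[of W]] by (auto simp: card_gt_0_iff)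

text \<open>Two points are related if no element of \<open>A\<close> separates them by a member of \<open>Q\<close>. The classes are
  open by equicontinuity and permuted by \<open>A\<close>.\<close>

lemma adapted_refinement:
  assumes Q: "finite Q" "\<And>C. C \<in> Q \<Longrightarrow> openin X C \<and> closedin X C" and x: "x \<in> S"
  obtains W where "W \<in> adapted_sets X A" "x \<in> W"
    "\<And>B C. B \<in> translates A W \<Longrightarrow> C \<in> Q \<Longrightarrow> B \<subseteq> C \<or> B \<inter> C = {}"
proof -
  define R where "R y z \<longleftrightarrow> (\<forall>f\<in>A. \<forall>C\<in>Q. f y \<in> C \<longleftrightarrow> f z \<in> C)" for y z
  define cl where "cl y = {z \<in> S. R y z}" for y
  have R_refl: "R y y" and R_sym: "R y z \<Longrightarrow> R z y" and R_trans: "R y z \<Longrightarrow> R z w \<Longrightarrow> R y w" for y z w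
    by (auto simp: R_def)
  \<comment> \<open>Each member of \<open>Q\<close> contributes a neighbourhood by equicontinuity,
    and finiteness of \<open>Q\<close> keeps the intersection open. Intersecting with
    \<open>S\<close> takes care of empty \<open>Q\<close>.\<close>
  have nbhd: "\<exists>V. openin X V \<and> z \<in> V \<and> (\<forall>y\<in>V. R z y)" if z: "z \<in> S" for z
  proof -
    have "\<forall>C\<in>Q. \<exists>V. openin X V \<and> z \<in> V \<and> (\<forall>y\<in>V. \<forall>f\<in>A. f y \<in> C \<longleftrightarrow> f z \<in> C)"
      using equicontinuous[OF _ _ z] Q(2) by blast
    then obtain V where V: "\<And>C. C \<in> Q \<Longrightarrow> openin X (V C) \<and> z \<in> V C \<and> (\<forall>y\<in>V C. \<forall>f\<in>A. f y \<in> C \<longleftrightarrow> f z \<in> C)"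
      by metis
    show ?thesis
    proof (intro exI conjI)
      show "openin X (S \<inter> \<Inter>(V ` Q))"
        using Q(1) V by (intro openin_Int_Inter) auto
      show "z \<in> S \<inter> \<Inter>(V ` Q)" using z V by auto
      show "\<forall>y\<in>S \<inter> \<Inter>(V ` Q). R z y"
        unfolding R_def
      proof (intro ballI)
        fix y f C assume *: "y \<in> S \<inter> \<Inter>(V ` Q)" "f \<in> A" "C \<in> Q"
        then have "y \<in> V C" by auto
        then show "f z \<in> C \<longleftrightarrow> f y \<in> C" using V[OF *(3)] *(2) by blast
      qed
    qed
  qed
  have open_cl: "openin X (cl y)" for y
  proof (subst openin_subopen, intro ballI)
    fix z assume z: "z \<in> cl y"
    then obtain V where "openin X V" "z \<in> V" "\<forall>y\<in>V. R z y" using nbhd by (auto simp: cl_def)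
    moreover have "V \<subseteq> cl y"
      using calculation(3) z R_trans openin_subset[OF calculation(1)] by (auto simp: cl_def)
    ultimately show "\<exists>T. openin X T \<and> z \<in> T \<and> T \<subseteq> cl y" by blast
  qed
  have closed_cl: "closedin X (cl y)" for y
  proof -
    have "S - cl y = \<Union>(cl ` (S - cl y))"
    proof (intro subset_antisym subsetI)
      fix z assume "z \<in> S - cl y"
      then show "z \<in> \<Union>(cl ` (S - cl y))" using R_refl[of z] by (auto simp: cl_def)
    next
      fix w assume "w \<in> \<Union>(cl ` (S - cl y))"
      then obtain z where z: "z \<in> S" "z \<notin> cl y" "w \<in> S" "R z w" by (auto simp: cl_def)
      have "\<not> R y w" using z R_trans[of y w z] R_sym[of z w] by (auto simp: cl_def)
      then show "w \<in> S - cl y" using z by (simp add: cl_def)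
    qed
    moreover have "openin X (\<Union>(cl ` (S - cl y)))" using open_cl by blast
    ultimately show ?thesis by (simp add: closedin_def) (auto simp: cl_def)
  qed
  \<comment> \<open>\<open>R\<close> quantifies over all of \<open>A\<close>, and \<open>g\<close>
    after \<open>f\<close> is again in \<open>A\<close>, so \<open>R\<close> is invariant.\<close>
  have R_image: "R (f y) (f z)" if f: "f \<in> A" and yz: "R y z" "y \<in> S" "z \<in> S" for f y z
    unfolding R_def
  proof (intro ballI)
    fix g C assume g: "g \<in> A" "C \<in> Q"
    obtain k where "k \<in> A" "\<And>x. x \<in> S \<Longrightarrow> k x = g (f x)"
      by (rule compose_ex[OF g(1) f]) blast
    then show "g (f y) \<in> C \<longleftrightarrow> g (f z) \<in> C" using yz g(2) unfolding R_def by metis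
  qed
  have image_cl: "f ` cl y = cl (f y)" if f: "f \<in> A" and y: "y \<in> S" for f y
  proof (intro subset_antisym subsetI)
    fix w assume "w \<in> f ` cl y"
    then show "w \<in> cl (f y)" using R_image[OF f] y maps_to[OF f] by (auto simp: cl_def)
  next
    fix w assume w: "w \<in> cl (f y)"
    obtain h where h: "h \<in> A" "\<And>x. x \<in> S \<Longrightarrow> h (f x) = x" "\<And>x. x \<in> S \<Longrightarrow> f (h x) = x"
      by (rule inverse_ex[OF f]) blast
    have "R (h (f y)) (h w)" using w R_image[OF h(1)] y maps_to[OF f] by (auto simp: cl_def)
    then have "h w \<in> cl y" using w h(2)[OF y] maps_to[OF h(1)] by (auto simp: cl_def)
    then show "w \<in> f ` cl y" using h(3)[of w] w by (metis (no_types, lifting) cl_def image_eqI mem_Collect_eq)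
  qed
  have cl_eq: "cl y = cl z" if w: "w \<in> cl y" "w \<in> cl z" for y z w
  proof -
    have "R y u \<longleftrightarrow> R z u" for u using w unfolding cl_def R_def by simp
    then show ?thesis by (simp add: cl_def)
  qed
  obtain e where e: "e \<in> A" "\<And>x. x \<in> S \<Longrightarrow> e x = x" by (rule one_ex) blast
  have x_cl: "x \<in> cl x" using x R_refl by (simp add: cl_def)
  have W: "cl x \<in> adapted_sets X A"
    unfolding adapted_sets_def block_def mem_Collect_eq
  proof (intro conjI open_cl closed_cl ballI impI)
    show "cl x \<noteq> {}" using x_cl by blast
    fix f assume f: "f \<in> A" and "f ` cl x \<inter> cl x \<noteq> {}"
    then obtain w where "w \<in> cl (f x)" "w \<in> cl x" using image_cl[OF f x] by blast
    then show "f ` cl x = cl x" unfolding image_cl[OF f x] by (rule cl_eq)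
  qed
  moreover note x_cl
  moreover have "B \<subseteq> C \<or> B \<inter> C = {}" if B: "B \<in> translates A (cl x)" and C: "C \<in> Q" for B C
  proof -
    obtain y where y: "B = cl y" using B image_cl x by (auto simp: translates_def)
    have "u \<in> C \<longleftrightarrow> v \<in> C" if "u \<in> B" "v \<in> B" for u v
    proof -
      have "R u v" "u \<in> S" "v \<in> S" using that unfolding y cl_def R_def by auto
      \<comment> \<open>The identity is among the maps tested by \<open>R\<close>, so related points
        lie in the same members of \<open>Q\<close>.\<close>
      then show ?thesis using e C unfolding R_def by metis
    qed
    then show ?thesis by blast
  qed
  ultimately show ?thesis by (rule that)
qed

text \<open>Refine by a single clopen \<open>C\<close> around \<open>x\<close> inside
  \<open>V\<close>: \<open>W\<close> is one of its own translates, so it lies in \<open>C\<close> or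
  misses it, and \<open>x\<close> excludes the latter.\<close>

lemma adapted_neighbourhood:
  assumes "openin X V" "x \<in> V"
  obtains W where "W \<in> adapted_sets X A" "x \<in> W" "W \<subseteq> V"
proof -
  obtain C where C: "openin X C" "closedin X C" "x \<in> C" "C \<subseteq> V"
    using clopen_base[OF assms] by blast
  have x: "x \<in> S" using C openin_subset by blast
  obtain W where W: "W \<in> adapted_sets X A" "x \<in> W"
    and ref: "\<And>B D. B \<in> translates A W \<Longrightarrow> D \<in> {C} \<Longrightarrow> B \<subseteq> D \<or> B \<inter> D = {}"
    by (rule adapted_refinement[of "{C}" x]) (use C x in auto)
  have "W \<subseteq> C" using ref[OF translates_self[OF adaptedD(5)[OF W(1)]], of C] W C by blast
  then show ?thesis using that[OF W] C by blast
qed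

end


section \<open>The completion of an equicontinuous action\<close>

lemma subgroup_BijGroupI:
  assumes "K \<subseteq> Bij S" "K \<noteq> {}"
    and "\<And>f g. f \<in> K \<Longrightarrow> g \<in> K \<Longrightarrow> compose S f g \<in> K"
    and "\<And>f. f \<in> K \<Longrightarrow> restrict (inv_into S f) S \<in> K"
  shows "subgroup K (BijGroup S)"
proof (rule group.subgroupI[OF group_BijGroup])
  show "K \<subseteq> carrier (BijGroup S)" using assms(1) by (simp add: BijGroup_def)
  show "inv\<^bsub>BijGroup S\<^esub> f \<in> K" if "f \<in> K" for f
    using assms(4)[OF that] inv_BijGroup[of f S] that assms(1) by (auto simp: restrict_def)
  show "f \<otimes>\<^bsub>BijGroup S\<^esub> g \<in> K" if "f \<in> K" "g \<in> K" for f g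
    using assms(3)[OF that] that assms(1) by (auto simp: BijGroup_def subset_eq)
qed fact

lemma Bij_inverse:
  assumes "f \<in> Bij S"
  shows "x \<in> S \<Longrightarrow> restrict (inv_into S f) S (f x) = x" "x \<in> S \<Longrightarrow> f (restrict (inv_into S f) S x) = x"
    "x \<in> S \<Longrightarrow> restrict (inv_into S f) S x \<in> S"
  using assms restrict_inv_into_Bij[OF assms]
  by (auto simp: Bij_def bij_betw_def inv_into_f_f f_inv_into_f inv_into_into)

text \<open>On \<open>K\<close> the map \<open>F\<close> factors through \<open>p\<close>. This
  shows that families indexed by a possibly infinite group have finitely many members.\<close>

lemma finite_image_factor:
  assumes "finite (p ` K)" "\<And>k l. k \<in> K \<Longrightarrow> l \<in> K \<Longrightarrow> p k = p l \<Longrightarrow> F k = F l"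
  shows "finite (F ` K)"
proof -
  have "F k = F (inv_into K p (p k))" if "k \<in> K" for k
    using assms(2)[of k "inv_into K p (p k)"] that f_inv_into_f[of "p k" p K] inv_into_into[of "p k" p K]
    by simp
  then have "F ` K \<subseteq> (\<lambda>s. F (inv_into K p s)) ` p ` K" by blast
  then show ?thesis using assms(1) by (meson finite_imageI finite_subset)
qed

context equicontinuous_system
begin

text \<open>A basic entourage of the uniform structure: for adapted \<open>W\<close> the translates
  partition \<open>S\<close>, and \<open>f\<close> and \<open>g\<close> send every point into the
  same piece.\<close>

definition close :: "'x set \<Rightarrow> ('x \<Rightarrow> 'x) \<Rightarrow> ('x \<Rightarrow> 'x) \<Rightarrow> bool" where
  "close W f g \<longleftrightarrow> (\<forall>x\<in>S. \<forall>B\<in>translates A W. f x \<in> B \<longleftrightarrow> g x \<in> B)"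

text \<open>This describes the closure of \<open>A\<close> in the uniform topology without reference to a metric.\<close>

definition completion :: "('x \<Rightarrow> 'x) set" where
  "completion = {f \<in> Bij S. \<forall>W\<in>adapted_sets X A. \<exists>g\<in>A. close W f g}"

lemma closeD: "close W f g \<Longrightarrow> B \<in> translates A W \<Longrightarrow> x \<in> S \<Longrightarrow> f x \<in> B \<longleftrightarrow> g x \<in> B"
  by (simp add: close_def)

lemma close_refl: "close W f f" and close_sym: "close W f g \<Longrightarrow> close W g f"
  and close_trans: "close W f g \<Longrightarrow> close W g h \<Longrightarrow> close W f h"
  by (simp_all add: close_def)

lemma subset_completion: "A \<subseteq> completion"
  using subset_Bij close_refl by (auto simp: completion_def)

lemma completion_close:
  assumes "f \<in> completion" "W \<in> adapted_sets X A"
  obtains g where "g \<in> A" "close W f g"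
  using assms by (auto simp: completion_def)

lemma completion_Bij: "f \<in> completion \<Longrightarrow> f \<in> Bij S"
  by (simp add: completion_def)

text \<open>\<open>g\<close> sends \<open>B\<close> into its image, which is a translate, so
  closeness makes \<open>f\<close> do the same; equality follows as \<open>f\<close> is onto and
  \<open>g\<close> injective. Hence elements of the completion permute the translates as elements of
  \<open>A\<close> do.\<close>

lemma close_image:
  assumes W: "W \<in> adapted_sets X A" and f: "f ` S = S" and g: "g \<in> A" "close W f g"
    and B: "B \<in> translates A W"
  shows "f ` B = g ` B"
proof -
  have gB: "g ` B \<in> translates A W" using translates_image[OF adaptedD(5)[OF W] g(1) B] .
  have BS: "B \<subseteq> S" using translates_subset[OF adaptedD(5)[OF W] B] .
  show ?thesis
  proof (intro subset_antisym subsetI)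
    fix y assume "y \<in> f ` B"
    then obtain x where "x \<in> B" "y = f x" by blast
    then show "y \<in> g ` B" using closeD[OF g(2) gB, of x] BS by auto
  next
    fix y assume y: "y \<in> g ` B"
    then have "y \<in> S" using translates_subset[OF adaptedD(5)[OF W] gB] by blast
    then obtain x where x: "x \<in> S" "y = f x" using f by blast
    then have "g x \<in> g ` B" using closeD[OF g(2) gB x(1)] y by simp
    then have "x \<in> B" using inj[OF g(1) x(1)] BS by auto
    then show "y \<in> f ` B" using x by simp
  qed
qed

text \<open>The values of \<open>f'\<close> and \<open>g'\<close> at a point share a piece
  \<open>C\<close>; \<open>g\<close> sends \<open>C\<close> onto a single piece, and closeness of
  \<open>f\<close> and \<open>g\<close> applies at \<open>f' x\<close>.\<close>

lemma close_compose:
  assumes W: "W \<in> adapted_sets X A" and g: "g \<in> A" "close W f g" and g': "close W f' g'"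
    and maps: "\<And>x. x \<in> S \<Longrightarrow> f' x \<in> S" "\<And>x. x \<in> S \<Longrightarrow> g' x \<in> S"
  shows "close W (compose S f f') (compose S g g')"
  unfolding close_def
proof (intro ballI)
  fix x B assume x: "x \<in> S" and B: "B \<in> translates A W"
  obtain C where C: "C \<in> translates A W" "g' x \<in> C"
    by (rule translates_cover[OF W maps(2)[OF x]])
  have "f' x \<in> C" using closeD[OF g' C(1) x] C(2) by simp
  have "g ` C \<in> translates A W" using translates_image[OF adaptedD(5)[OF W] g(1) C(1)] .
  have "g (f' x) \<in> g ` C" "g (g' x) \<in> g ` C" using \<open>f' x \<in> C\<close> C by auto
  then have "g (f' x) \<in> B \<longleftrightarrow> g (g' x) \<in> B"
    using translates_disjoint[OF adaptedD(5,4)[OF W] B \<open>g ` C \<in> translates A W\<close>] by blast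
  moreover have "f (f' x) \<in> B \<longleftrightarrow> g (f' x) \<in> B" using closeD[OF g(2) B maps(1)[OF x]] .
  ultimately show "compose S f f' x \<in> B \<longleftrightarrow> compose S g g' x \<in> B"
    using x by (simp add: compose_eq)
qed

text \<open>The inverse of a bijection sends \<open>y\<close> into \<open>B\<close> exactly when
  \<open>y\<close> is in the image of \<open>B\<close>, and these images agree for \<open>f\<close>
  and \<open>g\<close> by \<open>close_image\<close>.\<close>

lemma close_inverse:
  assumes W: "W \<in> adapted_sets X A" and f: "f \<in> Bij S" and g: "g \<in> A" "close W f g"
  shows "close W (restrict (inv_into S f) S) (restrict (inv_into S g) S)"
  unfolding close_def
proof (intro ballI)
  let ?f = "restrict (inv_into S f) S" and ?g = "restrict (inv_into S g) S"
  fix y B assume y: "y \<in> S" and B: "B \<in> translates A W"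
  have gB: "g \<in> Bij S" using g subset_Bij by blast
  have im: "f ` B = g ` B"
    by (rule close_image[OF W _ g B]) (use f in \<open>simp add: Bij_def bij_betw_def\<close>)
  have BS: "B \<subseteq> S" using translates_subset[OF adaptedD(5)[OF W] B] .
  have "k y \<in> B \<longleftrightarrow> y \<in> h ` B" if "h \<in> Bij S" "k = restrict (inv_into S h) S" for h k
  proof
    assume "k y \<in> B"
    then show "y \<in> h ` B" using Bij_inverse(2)[OF that(1) y] that(2) by (metis image_eqI)
  next
    assume "y \<in> h ` B"
    then obtain z where z: "z \<in> B" "y = h z" by blast
    have "k y = z"
      unfolding z(2) that(2) by (rule Bij_inverse(1)[OF that(1)]) (use z(1) BS in blast)
    then show "k y \<in> B" using z(1) by simp
  qed
  then show "?f y \<in> B \<longleftrightarrow> ?g y \<in> B" using im f gB by metis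
qed

lemma subgroup_completion: "subgroup completion (BijGroup S)"
proof (rule subgroup_BijGroupI)
  show "completion \<subseteq> Bij S" using completion_Bij by blast
  show "completion \<noteq> {}" using subset_completion one_ex by blast
  fix f assume f: "f \<in> completion"
  show "compose S f f' \<in> completion" if f': "f' \<in> completion" for f'
    unfolding completion_def
  proof (intro CollectI conjI ballI compose_Bij completion_Bij f f')
    fix W assume W: "W \<in> adapted_sets X A"
    obtain g where g: "g \<in> A" "close W f g" by (rule completion_close[OF f W])
    obtain g' where g': "g' \<in> A" "close W f' g'" by (rule completion_close[OF f' W])
    have f'S: "f' x \<in> S" if "x \<in> S" for x
      using completion_Bij[OF f'] that by (auto dest: Bij_imp_funcset)
    have "close W (compose S f f') (compose S g g')"
      by (rule close_compose[OF W g g'(2) f'S maps_to[OF g'(1)]])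
    then show "\<exists>h\<in>A. close W (compose S f f') h" using compose_closed g(1) g'(1) by blast
  qed
  show "restrict (inv_into S f) S \<in> completion"
    unfolding completion_def
  proof (intro CollectI conjI ballI restrict_inv_into_Bij completion_Bij f)
    fix W assume W: "W \<in> adapted_sets X A"
    obtain g where g: "g \<in> A" "close W f g" by (rule completion_close[OF f W])
    have gB: "g \<in> Bij S" using g subset_Bij by blast
    have "restrict (inv_into S g) S \<in> A"
      using subgroup.m_inv_closed[OF subgroup_Bij g(1)] inv_BijGroup[OF gB]
      by (simp add: restrict_def)
    then show "\<exists>h\<in>A. close W (restrict (inv_into S f) S) h"
      using close_inverse[OF W completion_Bij[OF f] g] by blast
  qed
qed

sublocale C: transformation_group S completion
  by (rule transformation_group.intro[OF subgroup_completion])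

lemma completion_translates:
  assumes W: "W \<in> adapted_sets X A" and f: "f \<in> completion" and B: "B \<in> translates A W"
  shows "f ` B \<in> translates A W"
proof -
  obtain g where g: "g \<in> A" "close W f g" by (rule completion_close[OF f W])
  have "f ` B = g ` B"
    using close_image[OF W _ g B] C.bij[OF f] by (simp add: bij_betw_def)
  then show ?thesis using translates_image[OF adaptedD(5)[OF W] g(1) B] by simp
qed

text \<open>A uniform limit of continuous maps: the preimage of \<open>W\<close> under
  \<open>f\<close> equals that under the approximating \<open>g\<close>, hence is open. Stated for
  self-maps so that it also covers limits not yet known to be bijective.\<close>

lemma close_continuous:
  assumes f: "\<And>x. x \<in> S \<Longrightarrow> f x \<in> S" and cl: "\<And>W. W \<in> adapted_sets X A \<Longrightarrow> \<exists>g\<in>A. close W f g"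
  shows "continuous_map X X f"
  unfolding continuous_map
proof (intro conjI allI impI)
  show "f ` S \<subseteq> S" using f by blast
  fix V assume V: "openin X V"
  show "openin X {x \<in> S. f x \<in> V}"
  proof (subst openin_subopen, intro ballI)
    fix x assume x: "x \<in> {x \<in> S. f x \<in> V}"
    obtain W where W: "W \<in> adapted_sets X A" "f x \<in> W" "W \<subseteq> V"
      by (rule adapted_neighbourhood[OF V]) (use x in auto)
    obtain g where g: "g \<in> A" "close W f g" using cl[OF W(1)] by blast
    have WW: "W \<in> translates A W" using translates_self[OF adaptedD(5)[OF W(1)]] .
    have "openin X {x \<in> S. g x \<in> W}"
      using openin_continuous_map_preimage[OF continuous[OF g(1)] adaptedD(2)[OF W(1)]] .
    moreover have "{x \<in> S. g x \<in> W} = {x \<in> S. f x \<in> W}" using closeD[OF g(2) WW] by blast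
    ultimately show "\<exists>T. openin X T \<and> x \<in> T \<and> T \<subseteq> {x \<in> S. f x \<in> V}"
      using x W by (intro exI[of _ "{x \<in> S. f x \<in> W}"]) auto
  qed
qed

lemma completion_continuous: "f \<in> completion \<Longrightarrow> continuous_map X X f"
  by (rule close_continuous) (use C.maps_to in \<open>auto simp: completion_def\<close>)

text \<open>Approximation by bijections at every adapted set forces bijectivity. If
  \<open>f x = f y\<close>, take an adapted \<open>W\<close> containing \<open>x\<close> but not
  \<open>y\<close>: the approximating \<open>g\<close> then sends \<open>y\<close> into the image of
  \<open>W\<close>, a contradiction. If a point is missed, some adapted set avoids the compact,
  hence closed, image; but the surjective \<open>g\<close> hits that set, and \<open>f\<close> with
  it.\<close>

lemma limit_in_completion:
  assumes f: "f \<in> extensional S" "\<And>x. x \<in> S \<Longrightarrow> f x \<in> S"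
    and cl: "\<And>W. W \<in> adapted_sets X A \<Longrightarrow> \<exists>g\<in>A. close W f g"
  shows "f \<in> completion"
proof -
  have cont: "continuous_map X X f" by (rule close_continuous[OF f(2) cl])
  have "inj_on f S"
  proof (rule inj_onI, rule ccontr)
    fix x y assume xy: "x \<in> S" "y \<in> S" "f x = f y" "x \<noteq> y"
    obtain U V where UV: "openin X U" "openin X V" "x \<in> U" "y \<in> V" "disjnt U V"
      using Hausdorff xy unfolding Hausdorff_space_def by blast
    obtain W where W: "W \<in> adapted_sets X A" "x \<in> W" "W \<subseteq> U"
      by (rule adapted_neighbourhood[OF UV(1,3)])
    obtain g where g: "g \<in> A" "close W f g" using cl[OF W(1)] by blast
    have "W \<in> translates A W" using translates_self[OF adaptedD(5)[OF W(1)]] .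
    then have gW: "g ` W \<in> translates A W" using translates_image[OF adaptedD(5)[OF W(1)] g(1)] by blast
    have "f x \<in> g ` W" using closeD[OF g(2) gW xy(1)] W(2) by simp
    then have "g y \<in> g ` W" using closeD[OF g(2) gW xy(2)] xy(3) by simp
    then have "y \<in> W" using inj[OF g(1) xy(2)] adaptedD(5)[OF W(1)] by auto
    then show False using UV W(3) by (auto simp: disjnt_def)
  qed
  moreover have "f ` S = S"
  proof (rule ccontr)
    assume "f ` S \<noteq> S"
    then obtain y where y: "y \<in> S - f ` S" using f(2) by blast
    have "compactin X (f ` S)"
      using image_compactin[OF _ cont] compact unfolding compact_space_def by blast
    then have "closedin X (f ` S)" using compactin_imp_closedin[OF Hausdorff] by blast
    then have "openin X (S - f ` S)" by blast
    then obtain W where W: "W \<in> adapted_sets X A" "y \<in> W" "W \<subseteq> S - f ` S"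
      by (rule adapted_neighbourhood[OF _ y])
    obtain g where g: "g \<in> A" "close W f g" using cl[OF W(1)] by blast
    obtain x where x: "x \<in> S" "y = g x" using bij[OF g(1)] y by (auto simp: bij_betw_def)
    have "W \<in> translates A W" using translates_self[OF adaptedD(5)[OF W(1)]] .
    then have "f x \<in> W" using closeD[OF g(2) _ x(1), of W] x(2) W(2) by simp
    then show False using W(3) x(1) by blast
  qed
  ultimately show ?thesis
    using f(1) cl by (simp add: completion_def Bij_def bij_betw_def)
qed

section \<open>Finiteness and compactness in the completion\<close>

text \<open>Turns the relation \<open>close W\<close> into equality of a value, so that closeness
  classes can be counted as an image.\<close>

definition pattern :: "'x set \<Rightarrow> ('x \<Rightarrow> 'x) \<Rightarrow> ('x \<times> 'x set) set" where
  "pattern W f = {(x, B). x \<in> S \<and> B \<in> translates A W \<and> f x \<in> B}"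

lemma close_iff_pattern: "close W f g \<longleftrightarrow> pattern W f = pattern W g"
  unfolding close_def pattern_def by auto

text \<open>The pattern of \<open>k\<close> is determined by the permutation that \<open>k\<close>
  induces on the finitely many translates: if \<open>x\<close> is in \<open>B\<close>, then
  \<open>k x\<close> is in the image of \<open>B\<close>. The permutation is coded by its graph, a
  subset of a finite product.\<close>

lemma finite_patterns:
  assumes W: "W \<in> adapted_sets X A"
  shows "finite (pattern W ` completion)"
proof (rule finite_image_factor)
  let ?P = "translates A W"
  define p where "p k = (\<lambda>B. (B, k ` B)) ` ?P" for k :: "'x \<Rightarrow> 'x"
  show "finite (p ` completion)"
  proof (rule finite_subset)
    show "p ` completion \<subseteq> Pow (?P \<times> ?P)" using completion_translates[OF W] by (auto simp: p_def)
  qed (use finite_translates[OF W] in simp)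
  fix k l assume k: "k \<in> completion" and l: "l \<in> completion" and eq: "p k = p l"
  have "close W k l"
    unfolding close_def
  proof (intro ballI)
    fix x C assume x: "x \<in> S" and C: "C \<in> ?P"
    obtain B where B: "B \<in> ?P" "x \<in> B" by (rule translates_cover[OF W x])
    have "(B, k ` B) \<in> p l" using B(1) unfolding eq[symmetric] by (simp add: p_def)
    then have kl: "k ` B = l ` B" by (auto simp: p_def)
    have "k x \<in> k ` B" "l x \<in> k ` B" using B(2) kl by auto
    moreover have "k ` B \<in> ?P" using completion_translates[OF W k B(1)] .
    ultimately show "k x \<in> C \<longleftrightarrow> l x \<in> C"
      using translates_disjoint[OF adaptedD(5,4)[OF W] C] by blast
  qed
  then show "pattern W k = pattern W l" by (simp add: close_iff_pattern)
qed

text \<open>Inside the completion, \<open>N\<close> is saturated for the closeness relation of one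
  fixed \<open>W\<close>. For subgroups and adapted \<open>W\<close> this amounts to openness in the
  uniform topology, see \<open>openin_uniform_topology_iff\<close>.\<close>

definition open_in_completion :: "('x \<Rightarrow> 'x) set \<Rightarrow> 'x set \<Rightarrow> bool" where
  "open_in_completion N W \<longleftrightarrow> (\<forall>n\<in>N. \<forall>k\<in>completion. close W k n \<longrightarrow> k \<in> N)"

text \<open>\<open>N\<close> is compact in the topology of pointwise convergence: it is an intersection of
  closed subsets of the power of \<open>X\<close>.\<close>

lemma closedin_evaluation:
  assumes N: "N \<subseteq> completion" and W0: "W0 \<in> adapted_sets X A" "open_in_completion N W0"
    and x: "x \<in> S"
  shows "closedin X ((\<lambda>n. n x) ` N)"
proof -
  let ?T = "product_topology (\<lambda>_. X) S"
  define F where "F W = {f \<in> topspace ?T. \<exists>n\<in>N. close W f n}" for W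
  have closed_close: "closedin ?T {f \<in> topspace ?T. close W f n}"
    if W: "W \<in> adapted_sets X A" and n: "n \<in> completion" for W n
  proof -
    \<comment> \<open>It suffices that \<open>n y \<in> B\<close> implies
      \<open>f y \<in> B\<close>: the pieces are disjoint, so \<open>f y\<close> can be in no other
      piece.\<close>
    let ?I = "{(y, B). y \<in> S \<and> B \<in> translates A W \<and> n y \<in> B}"
    have "{f \<in> topspace ?T. close W f n} = (\<Inter>(y, B)\<in>?I. {f \<in> topspace ?T. f y \<in> B})"
    proof (intro subset_antisym subsetI)
      fix f assume "f \<in> {f \<in> topspace ?T. close W f n}"
      then show "f \<in> (\<Inter>(y, B)\<in>?I. {f \<in> topspace ?T. f y \<in> B})"
        using closeD[of W f n] by auto
    next
      fix f assume f: "f \<in> (\<Inter>(y, B)\<in>?I. {f \<in> topspace ?T. f y \<in> B})"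
      have fB: "f \<in> topspace ?T \<and> f y \<in> B" if "y \<in> S" "B \<in> translates A W" "n y \<in> B" for y B
        using f that by auto
      obtain y where y: "y \<in> S" using nonempty by blast
      obtain B where "B \<in> translates A W" "n y \<in> B" by (rule translates_cover[OF W C.maps_to[OF n y]])
      then have "f \<in> topspace ?T" using fB y by blast
      moreover have "close W f n"
        unfolding close_def
      proof (intro ballI iffI)
        fix y B assume y: "y \<in> S" and B: "B \<in> translates A W"
        show "f y \<in> B" if "n y \<in> B" using fB[OF y B that] by blast
        assume fy: "f y \<in> B"
        obtain C where C: "C \<in> translates A W" "n y \<in> C" by (rule translates_cover[OF W C.maps_to[OF n y]])
        then have "f y \<in> C" using fB[OF y] by blast
        then show "n y \<in> B" using translates_disjoint[OF adaptedD(5,4)[OF W] B C(1) fy] C(2) by blast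
      qed
      ultimately show "f \<in> {f \<in> topspace ?T. close W f n}" by blast
    qed
    moreover have "closedin ?T (\<Inter>(y, B)\<in>?I. {f \<in> topspace ?T. f y \<in> B})"
    proof (rule closedin_Inter)
      obtain y where y: "y \<in> S" using nonempty by blast
      obtain B where "B \<in> translates A W" "n y \<in> B" by (rule translates_cover[OF W C.maps_to[OF n y]])
      then show "(\<lambda>(y, B). {f \<in> topspace ?T. f y \<in> B}) ` ?I \<noteq> {}" using y by auto
      fix Z assume "Z \<in> (\<lambda>(y, B). {f \<in> topspace ?T. f y \<in> B}) ` ?I"
      then obtain y B where Z: "Z = {f \<in> topspace ?T. f y \<in> B}" "y \<in> S" "B \<in> translates A W" by auto
      show "closedin ?T Z"
        unfolding Z(1)
        by (rule closedin_continuous_map_preimage[OF continuous_map_product_projection])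
          (use Z adaptedD(3)[OF adapted_translate[OF W]] in auto)
    qed
    ultimately show ?thesis by simp
  qed
  have "closedin ?T (F W)" if W: "W \<in> adapted_sets X A" for W
  proof -
    define G where "G n = {f \<in> topspace ?T. close W f n}" for n
    \<comment> \<open>A union over all of \<open>N\<close>, but with at most one distinct member per
      pattern, hence a finite union.\<close>
    have "F W = \<Union>(G ` N)" by (auto simp: F_def G_def)
    moreover have "finite (G ` N)"
    proof (rule finite_image_factor)
      show "finite (pattern W ` N)" using finite_patterns[OF W] N by (meson finite_subset image_mono)
      show "G k = G l" if "pattern W k = pattern W l" for k l
        using that by (simp add: G_def close_iff_pattern)
    qed
    moreover have "closedin ?T Z" if "Z \<in> G ` N" for Z
      using that closed_close[OF W] N by (auto simp: G_def)
    ultimately show ?thesis by (simp add: closedin_Union)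
  qed
  then have "closedin ?T (\<Inter>(F ` adapted_sets X A))"
    using W0(1) by (intro closedin_Inter) auto
  \<comment> \<open>A map approximated from \<open>N\<close> at every adapted set is in the
    completion by \<open>limit_in_completion\<close>; closeness at \<open>W0\<close> then puts it in
    \<open>N\<close>.\<close>
  moreover have "\<Inter>(F ` adapted_sets X A) = N"
  proof (intro subset_antisym subsetI)
    fix f assume "f \<in> \<Inter>(F ` adapted_sets X A)"
    then have f: "f \<in> topspace ?T" "\<And>W. W \<in> adapted_sets X A \<Longrightarrow> \<exists>n\<in>N. close W f n"
      using W0(1) by (auto simp: F_def)
    have "f \<in> completion"
    proof (rule limit_in_completion)
      show "f \<in> extensional S" "\<And>x. x \<in> S \<Longrightarrow> f x \<in> S" using f(1) by (auto simp: PiE_def)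
      fix W assume W: "W \<in> adapted_sets X A"
      obtain n where n: "n \<in> N" "close W f n" using f(2)[OF W] by blast
      obtain g where "g \<in> A" "close W n g" by (rule completion_close[of n, OF _ W]) (use n N in auto)
      then show "\<exists>g\<in>A. close W f g" using close_trans[OF n(2)] by blast
    qed
    then show "f \<in> N" using f(2)[OF W0(1)] W0(2) by (auto simp: open_in_completion_def)
  next
    fix f assume f: "f \<in> N"
    then have "f \<in> topspace ?T" using N C.maps_to C.ext_on by (auto simp: PiE_def)
    then show "f \<in> \<Inter>(F ` adapted_sets X A)" using f close_refl by (auto simp: F_def)
  qed
  moreover have "compact_space ?T" using compact by (simp add: compact_space_product_topology)
  ultimately have "compactin ?T N" using closedin_compact_space by metis
  then have "compactin X ((\<lambda>n. n x) ` N)"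
    using image_compactin continuous_map_product_projection[OF x, of "\<lambda>_. X"] by blast
  then show ?thesis using compactin_imp_closedin[OF Hausdorff] by blast
qed

text \<open>The orbit of \<open>x\<close> under the completion is closed by compactness, and dense
  because it contains the orbit under \<open>A\<close>.\<close>

lemma completion_transitive:
  assumes x: "x \<in> S" and y: "y \<in> S"
  obtains k where "k \<in> completion" "k x = y"
proof -
  obtain W where W: "W \<in> adapted_sets X A"
    by (rule adapted_neighbourhood[OF openin_topspace x])
  have closed: "closedin X ((\<lambda>n. n x) ` completion)"
    by (rule closedin_evaluation[OF subset_refl W _ x]) (simp add: open_in_completion_def)
  have "y \<in> (\<lambda>n. n x) ` completion"
  proof (rule ccontr)
    assume "y \<notin> (\<lambda>n. n x) ` completion"
    then have "S - (\<lambda>n. n x) ` completion \<noteq> {}" using y by blast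
    moreover have "openin X (S - (\<lambda>n. n x) ` completion)" using closed by blast
    ultimately obtain f where "f \<in> A" "f x \<in> S - (\<lambda>n. n x) ` completion"
      using minimal x by blast
    then show False using subset_completion by blast
  qed
  then show ?thesis using that by blast
qed

text \<open>\<open>m\<close> is \<open>l\<close> followed by the inverse of \<open>k\<close>.
  Closeness is left invariant, so comparing two elements reduces to a statement near the identity,
  where subgroups can be used.\<close>

lemma close_quotient:
  assumes W: "W \<in> adapted_sets X A" and k: "k \<in> completion" "l \<in> completion" "close W k l"
  obtains m where "m \<in> completion" "\<And>y. y \<in> S \<Longrightarrow> l y = k (m y)" "close W m (\<lambda>y. y)"
proof -
  obtain h where h: "h \<in> completion" "\<And>y. y \<in> S \<Longrightarrow> h (k y) = y" "\<And>y. y \<in> S \<Longrightarrow> k (h y) = y"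
    by (rule C.inverse_ex[OF k(1)]) blast
  obtain m where m: "m \<in> completion" "\<And>y. y \<in> S \<Longrightarrow> m y = h (l y)"
    by (rule C.compose_ex[OF h(1) k(2)]) blast
  have lk: "l y = k (m y)" if "y \<in> S" for y
    using h(3)[OF C.maps_to[OF k(2) that]] m(2)[OF that] by simp
  have "close W m (\<lambda>y. y)"
    unfolding close_def
  proof (intro ballI)
    fix y B assume y: "y \<in> S" and B: "B \<in> translates A W"
    have BS: "B \<subseteq> S" using translates_subset[OF adaptedD(5)[OF W] B] .
    have kB: "k ` B \<in> translates A W" using completion_translates[OF W k(1) B] .
    have "m y \<in> B \<longleftrightarrow> l y \<in> k ` B"
      unfolding lk[OF y] using C.inj[OF k(1) C.maps_to[OF m(1) y]] BS by auto
    also have "\<dots> \<longleftrightarrow> k y \<in> k ` B" using closeD[OF k(3) kB y] by simp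
    also have "\<dots> \<longleftrightarrow> y \<in> B" using C.inj[OF k(1) y] BS by auto
    finally show "m y \<in> B \<longleftrightarrow> y \<in> B" .
  qed
  then show ?thesis using that m(1) lk by blast
qed

text \<open>\<open>l\<close> is \<open>k\<close> after some \<open>m\<close> close to the identity;
  openness puts \<open>m\<close> in \<open>N\<close>, which preserves its own orbit.\<close>

lemma close_orbit_subset:
  assumes N: "subgroup N (BijGroup S)" "N \<subseteq> completion"
    and W: "W \<in> adapted_sets X A" "open_in_completion N W"
    and k: "k \<in> completion" "l \<in> completion" "close W k l" and x: "x \<in> S"
  shows "l ` (\<lambda>n. n x) ` N \<subseteq> k ` (\<lambda>n. n x) ` N"
proof -
  interpret N: transformation_group S N by (rule transformation_group.intro[OF N(1)])
  obtain e where e: "e \<in> N" "\<And>y. y \<in> S \<Longrightarrow> e y = y" by (rule N.one_ex) blast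
  obtain m where m: "m \<in> completion" "\<And>y. y \<in> S \<Longrightarrow> l y = k (m y)" "close W m (\<lambda>y. y)"
    by (rule close_quotient[OF W(1) k]) blast
  have "close W m e" using m(3) e(2) by (simp add: close_def)
  then have mN: "m \<in> N" using W(2) e(1) m(1) by (auto simp: open_in_completion_def)
  show ?thesis
  proof clarify
    fix n assume n: "n \<in> N"
    obtain q where q: "q \<in> N" "\<And>y. y \<in> S \<Longrightarrow> q y = m (n y)"
      by (rule N.compose_ex[OF mN n]) blast
    have "l (n x) = k (q x)" using q(2)[OF x] m(2)[OF N.maps_to[OF n x]] by simp
    then show "l (n x) \<in> k ` (\<lambda>n. n x) ` N" using q(1) by blast
  qed
qed

text \<open>The orbit is closed by compactness. It has finitely many translates, because the
  translate by \<open>k\<close> depends only on the pattern of \<open>k\<close>, and they cover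
  \<open>S\<close> by transitivity; so the complement of the orbit is a finite union of closed sets.
  Replacing \<open>k\<close> by a close element of \<open>A\<close> shows that the completion
  creates no further translates.\<close>

lemma normal_orbit_adapted:
  assumes N: "N \<lhd> (BijGroup S)\<lparr>carrier := completion\<rparr>"
    and W: "W \<in> adapted_sets X A" "open_in_completion N W" and x: "x \<in> S"
  defines "V \<equiv> (\<lambda>n. n x) ` N"
  shows "V \<in> adapted_sets X A" "translates completion V = translates A V"
proof -
  have sub: "subgroup N (BijGroup S)"
    using group.incl_subgroup[OF group_BijGroup subgroup_completion normal_imp_subgroup[OF N]] .
  have NK: "N \<subseteq> completion" using subgroup.subset[OF normal_imp_subgroup[OF N]] by simp
  interpret N: transformation_group S N by (rule transformation_group.intro[OF sub])
  have close_eq: "k ` V = l ` V" if "k \<in> completion" "l \<in> completion" "close W k l" for k l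
    unfolding V_def
    using close_orbit_subset[OF sub NK W that x] close_orbit_subset[OF sub NK W that(2,1) close_sym[OF that(3)] x]
    by (rule subset_antisym[rotated])
  have block: "block completion V"
    unfolding V_def by (rule C.block_normal_orbit[OF N x])
  have VS: "V \<subseteq> S" using N.maps_to[OF _ x] by (auto simp: V_def)
  obtain e where e: "e \<in> N" "\<And>y. y \<in> S \<Longrightarrow> e y = y" by (rule N.one_ex) blast
  have xV: "x \<in> V" using e(1) e(2)[OF x] unfolding V_def by (metis image_eqI)
  have "finite (translates completion V)"
    unfolding translates_def
    by (rule finite_image_factor[OF finite_patterns[OF W(1)]])
      (rule close_eq; simp add: close_iff_pattern)
  moreover have "closedin X B" if B: "B \<in> translates completion V" for B
  proof -
    obtain k where k: "k \<in> completion" "B = k ` V" using B by (auto simp: translates_def)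
    have "compactin X V"
      using closedin_evaluation[OF NK W x] closedin_compact_space[OF compact] by (simp add: V_def)
    then have "compactin X B"
      unfolding k(2) using image_compactin completion_continuous[OF k(1)] by blast
    then show ?thesis using compactin_imp_closedin[OF Hausdorff] by blast
  qed
  ultimately have closed: "closedin X (\<Union>(translates completion V - {V}))"
    by (intro closedin_Union) auto
  have compl: "\<Union>(translates completion V - {V}) = S - V"
  proof (intro subset_antisym subsetI)
    fix y assume "y \<in> \<Union>(translates completion V - {V})"
    then obtain B where B: "B \<in> translates completion V" "B \<noteq> V" "y \<in> B" by blast
    then show "y \<in> S - V"
      using C.translates_disjoint[OF VS block B(1) C.translates_self[OF VS]]
        C.translates_subset[OF VS B(1)] by blast
  next
    fix y assume y: "y \<in> S - V"
    obtain k where k: "k \<in> completion" "k x = y" by (rule completion_transitive[OF x, of y]) (use y in auto)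
    then have "y \<in> k ` V" "k ` V \<in> translates completion V" using xV by (auto simp: translates_def)
    then show "y \<in> \<Union>(translates completion V - {V})" using y by blast
  qed
  have "openin X V" using closed VS unfolding compl by (simp add: openin_closedin)
  moreover have "closedin X V" using closedin_evaluation[OF NK W x] by (simp add: V_def)
  moreover have "block A V" using block subset_completion by (auto simp: block_def)
  ultimately show "V \<in> adapted_sets X A" using xV by (auto simp: adapted_sets_def)
  show "translates completion V = translates A V"
  proof
    show "translates A V \<subseteq> translates completion V"
      using subset_completion by (auto simp: translates_def)
    show "translates completion V \<subseteq> translates A V"
    proof
      fix B assume "B \<in> translates completion V"
      then obtain k where k: "k \<in> completion" "B = k ` V" by (auto simp: translates_def)
      obtain g where g: "g \<in> A" "close W k g" by (rule completion_close[OF k(1) W(1)])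
      have "B = g ` V" unfolding k(2) by (rule close_eq[OF k(1) _ g(2)]) (use g subset_completion in auto)
      then show "B \<in> translates A V" using g(1) by (auto simp: translates_def)
    qed
  qed
qed

end


section \<open>The Steinitz index\<close>

lemma exponent_steinitz_LCM: "exponent (steinitz_LCM T) p = (SUP P\<in>T. exponent P p)"
  by (simp add: steinitz_LCM.rep_eq image_image)

lemma exponent_eqI: "(\<And>p. exponent P p = exponent Q p) \<Longrightarrow> P = Q"
  by (meson exponent_inject ext)

text \<open>Each family is cofinal in the other for divisibility, so the suprema agree at every
  prime.\<close>

lemma steinitz_LCM_eqI:
  assumes "\<And>P. P \<in> T \<Longrightarrow> \<exists>Q\<in>U. \<forall>p. exponent P p \<le> exponent Q p"
    and "\<And>Q. Q \<in> U \<Longrightarrow> \<exists>P\<in>T. \<forall>p. exponent Q p \<le> exponent P p"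
  shows "steinitz_LCM T = steinitz_LCM U"
proof (rule exponent_eqI)
  fix p
  show "exponent (steinitz_LCM T) p = exponent (steinitz_LCM U) p"
    unfolding exponent_steinitz_LCM by (rule antisym; rule SUP_mono) (use assms in blast)+
qed

text \<open>Positivity matters: everything divides \<open>0\<close>, while
  \<open>multiplicity p 0\<close> is \<open>0\<close>.\<close>

lemma exponent_of_nat_dvd_le:
  assumes "m dvd n" "n > 0"
  shows "exponent (steinitz_of_nat m) p \<le> exponent (steinitz_of_nat n) p"
  using assms by (simp add: steinitz_of_nat.rep_eq dvd_imp_multiplicity_le)

text \<open>Adding a finite constant commutes with suprema in \<open>enat\<close>, except for the
  empty family, whose supremum is \<open>0\<close>.\<close>

lemma steinitz_LCM_of_nat_mult:
  assumes "T \<noteq> {}"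
  shows "steinitz_LCM ((*) (steinitz_of_nat n) ` T) = steinitz_of_nat n * steinitz_LCM T"
proof (rule exponent_eqI)
  fix p
  obtain c where c: "exponent (steinitz_of_nat n) p = enat c"
    by (cases "prime p") (simp_all add: steinitz_of_nat.rep_eq zero_enat_def)
  let ?s = "SUP P\<in>T. exponent P p"
  have "(SUP P\<in>T. enat c + exponent P p) = enat c + ?s"
  proof (rule antisym)
    show "(SUP P\<in>T. enat c + exponent P p) \<le> enat c + ?s"
      by (intro SUP_least add_left_mono SUP_upper)
    show "enat c + ?s \<le> (SUP P\<in>T. enat c + exponent P p)"
    proof (cases "SUP P\<in>T. enat c + exponent P p")
      \<comment> \<open>Only a finite supremum needs an argument: \<open>c\<close> is subtracted
        from the bound, and a member of \<open>T\<close> shows that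
        \<open>c \<le> t\<close>.\<close>
      case (enat t)
      have le: "enat c + exponent P p \<le> enat t" if "P \<in> T" for P
        using that SUP_upper[of P T "\<lambda>P. enat c + exponent P p"] enat by simp
      obtain P where "P \<in> T" using assms by blast
      then have ct: "c \<le> t" using le[of P] by (cases "exponent P p") auto
      have "exponent P p \<le> enat (t - c)" if "P \<in> T" for P
        using le[OF that] by (cases "exponent P p") auto
      then have "?s \<le> enat (t - c)" by (rule SUP_least)
      then have "enat c + ?s \<le> enat c + enat (t - c)" by (rule add_left_mono)
      then show ?thesis using enat ct by simp
    qed simp
  qed
  then show "exponent (steinitz_LCM ((*) (steinitz_of_nat n) ` T)) p
      = exponent (steinitz_of_nat n * steinitz_LCM T) p"
    by (simp add: exponent_steinitz_LCM times_steinitz.rep_eq image_image c)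
qed

lemma (in transformation_group) normalI_Bij:
  assumes N: "subgroup N (BijGroup S)" "N \<subseteq> A"
    and conj: "\<And>f n. f \<in> A \<Longrightarrow> n \<in> N \<Longrightarrow> compose S (compose S f n) (restrict (inv_into S f) S) \<in> N"
  shows "N \<lhd> (BijGroup S)\<lparr>carrier := A\<rparr>"
proof -
  let ?G = "BijGroup S" and ?K = "(BijGroup S)\<lparr>carrier := A\<rparr>"
  interpret G: group ?G by (rule group_BijGroup)
  interpret K: group ?K by (rule subgroup.subgroup_is_group[OF subgroup_Bij G.is_group])
  have "f \<otimes>\<^bsub>?K\<^esub> n \<otimes>\<^bsub>?K\<^esub> inv\<^bsub>?K\<^esub> f \<in> N" if f: "f \<in> A" and n: "n \<in> N" for f n
  proof -
    have B: "f \<in> Bij S" "n \<in> Bij S" using f n N(2) subset_Bij by auto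
    have "inv\<^bsub>?K\<^esub> f = restrict (inv_into S f) S"
      using G.m_inv_consistent[OF subgroup_Bij f] inv_BijGroup[OF B(1)] by (simp add: restrict_def)
    then show ?thesis
      using conj[OF f n] B restrict_inv_into_Bij[OF B(1)] compose_Bij[OF B] by (simp add: BijGroup_def)
  qed
  then show ?thesis
    using G.subgroup_incl[OF N(1) subgroup_Bij N(2)] by (simp add: K.normal_inv_iff)
qed

section \<open>Kernels of the action on translates, and the index as a Steinitz order\<close>

context equicontinuous_system
begin

definition kernel :: "'x set \<Rightarrow> ('x \<Rightarrow> 'x) set" where
  "kernel W = {k \<in> completion. \<forall>B\<in>translates A W. k ` B = B}"

text \<open>Like \<open>n\<close>, a close \<open>k\<close> sends points of \<open>B\<close> into
  \<open>B\<close>; so the image of \<open>B\<close> under \<open>k\<close> is a translate that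
  meets \<open>B\<close>, hence \<open>B\<close> itself.\<close>

lemma kernel_open:
  assumes W: "W \<in> adapted_sets X A"
  shows "open_in_completion (kernel W) W"
  unfolding open_in_completion_def
proof (intro ballI impI)
  fix n k assume n: "n \<in> kernel W" and k: "k \<in> completion" and cl: "close W k n"
  have "k ` B = B" if B: "B \<in> translates A W" for B
  proof -
    have nB: "n ` B = B" using n B by (simp add: kernel_def)
    obtain x where x: "x \<in> B" using adaptedD(1)[OF adapted_translate[OF W B]] by blast
    then have "x \<in> S" using translates_subset[OF adaptedD(5)[OF W] B] by blast
    moreover have "n x \<in> B" using nB x by blast
    ultimately have "k x \<in> B" using closeD[OF cl B, of x] by simp
    then show ?thesis
      using translates_disjoint[OF adaptedD(5,4)[OF W] completion_translates[OF W k B] B, of "k x"] x by blast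
  qed
  then show "k \<in> kernel W" using k by (simp add: kernel_def)
qed

lemma kernel_normal:
  assumes W: "W \<in> adapted_sets X A"
  shows "kernel W \<lhd> (BijGroup S)\<lparr>carrier := completion\<rparr>"
proof (rule C.normalI_Bij)
  have BS: "B \<subseteq> S" if "B \<in> translates A W" for B
    using translates_subset[OF adaptedD(5)[OF W] that] .
  have comp: "compose S f g ` B = f ` g ` B" if "B \<in> translates A W" for f g :: "'x \<Rightarrow> 'x" and B
    using BS[OF that] by (auto simp: compose_def image_image intro!: image_cong)
  have invl: "restrict (inv_into S f) S ` f ` B = B" "f ` restrict (inv_into S f) S ` B = B"
    if "B \<in> translates A W" "f \<in> completion" for f B
    unfolding image_image
    by (rule image_identI, use Bij_inverse[OF completion_Bij[OF that(2)]] BS[OF that(1)] in blast)+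
  have inv_mem: "restrict (inv_into S f) S \<in> completion" if f: "f \<in> completion" for f
    using subgroup.m_inv_closed[OF subgroup_completion f] inv_BijGroup[OF completion_Bij[OF f]]
    by (simp add: restrict_def)
  show "kernel W \<subseteq> completion" by (auto simp: kernel_def)
  show "subgroup (kernel W) (BijGroup S)"
  proof (rule subgroup_BijGroupI)
    show "kernel W \<subseteq> Bij S" using completion_Bij by (auto simp: kernel_def)
    obtain e where e: "e \<in> completion" "\<And>x. x \<in> S \<Longrightarrow> e x = x" by (rule C.one_ex) blast
    have "e ` B = B" if "B \<in> translates A W" for B
      by (rule image_identI) (use e(2) BS[OF that] in blast)
    then show "kernel W \<noteq> {}" using e(1) by (auto simp: kernel_def)
    fix f assume f: "f \<in> kernel W"
    show "compose S f g \<in> kernel W" if "g \<in> kernel W" for g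
      using f that C.compose_closed comp by (auto simp: kernel_def)
    have "restrict (inv_into S f) S ` B = B" if B: "B \<in> translates A W" for B
    proof -
      have "f \<in> completion" "f ` B = B" using f B by (auto simp: kernel_def)
      then show ?thesis using invl(1)[OF B] by metis
    qed
    then show "restrict (inv_into S f) S \<in> kernel W"
      using f inv_mem by (simp add: kernel_def)
  qed
  fix f n assume f: "f \<in> completion" and n: "n \<in> kernel W"
  let ?h = "restrict (inv_into S f) S"
  have nK: "n \<in> completion" using n by (simp add: kernel_def)
  have "compose S (compose S f n) ?h ` B = B" if B: "B \<in> translates A W" for B
  proof -
    \<comment> \<open>The inverse of \<open>f\<close> permutes the translates and \<open>n\<close>
      fixes each of them, so the conjugation cancels.\<close>
    have hB: "?h ` B \<in> translates A W" using completion_translates[OF W inv_mem[OF f] B] .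
    then have "n ` ?h ` B = ?h ` B" using n by (simp add: kernel_def)
    then show ?thesis unfolding comp[OF B] comp[OF hB] using invl(2)[OF B f] by simp
  qed
  then show "compose S (compose S f n) ?h \<in> kernel W"
    using C.compose_closed[OF C.compose_closed[OF f nK] inv_mem[OF f]] by (simp add: kernel_def)
qed

lemma translates_dvd:
  assumes W: "W \<in> adapted_sets X A" and V: "V \<in> adapted_sets X A" "V \<subseteq> W"
  shows "card (translates A W) dvd card (translates A V)"
  using card_translates_mult[OF adaptedD(5,4)[OF W] V(2) adaptedD(1,4)[OF V(1)] finite_translates[OF V(1)]]
  by simp

lemma steinitz_index_eq_LCM:
  assumes x: "x \<in> S"
  defines "\<N> \<equiv> {N. N \<lhd> (BijGroup S)\<lparr>carrier := completion\<rparr> \<and>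
                  (\<exists>W\<in>adapted_sets X A. open_in_completion N W)}"
  shows "steinitz_LCM ((\<lambda>N. steinitz_of_nat (card (translates completion ((\<lambda>n. n x) ` N)))) ` \<N>)
    = steinitz_index X A"
  unfolding steinitz_index_def
proof (rule steinitz_LCM_eqI)
  let ?f = "\<lambda>N. steinitz_of_nat (card (translates completion ((\<lambda>n. n x) ` N)))"
  let ?g = "\<lambda>W. steinitz_of_nat (card (translates A W))"
  fix P assume "P \<in> ?f ` \<N>"
  then obtain N W where N: "N \<lhd> (BijGroup S)\<lparr>carrier := completion\<rparr>" "W \<in> adapted_sets X A"
    "open_in_completion N W" "P = ?f N" by (auto simp: \<N>_def)
  then have "P = ?g ((\<lambda>n. n x) ` N)" "(\<lambda>n. n x) ` N \<in> adapted_sets X A"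
    using normal_orbit_adapted[OF N(1-3) x] by auto
  then show "\<exists>Q\<in>?g ` adapted_sets X A. \<forall>p. exponent P p \<le> exponent Q p" by blast
next
  let ?f = "\<lambda>N. steinitz_of_nat (card (translates completion ((\<lambda>n. n x) ` N)))"
  let ?g = "\<lambda>W. steinitz_of_nat (card (translates A W))"
  fix Q assume "Q \<in> ?g ` adapted_sets X A"
  then obtain W where W: "W \<in> adapted_sets X A" "Q = ?g W" by blast
  \<comment> \<open>The orbit of \<open>x\<close> under \<open>kernel W\<close> lies in the
    translate through \<open>x\<close>, which may differ from \<open>W\<close> but has the same
    translates.\<close>
  obtain B where B: "B \<in> translates A W" "x \<in> B" by (rule translates_cover[OF W(1) x])
  let ?N = "kernel W" let ?V = "(\<lambda>n. n x) ` ?N"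
  note V = normal_orbit_adapted[OF kernel_normal[OF W(1)] W(1) kernel_open[OF W(1)] x]
  have "?V \<subseteq> B" using B by (auto simp: kernel_def)
  then have "card (translates A B) dvd card (translates A ?V)"
    by (rule translates_dvd[OF adapted_translate[OF W(1) B(1)] V(1)])
  then have "card (translates A W) dvd card (translates completion ?V)"
    using translates_translate[OF adaptedD(5)[OF W(1)] B(1)] V(2) by simp
  moreover have "card (translates completion ?V) > 0" using card_translates_pos[OF V(1)] V(2) by simp
  ultimately have "\<forall>p. exponent Q p \<le> exponent (?f ?N) p"
    using exponent_of_nat_dvd_le W(2) by blast
  moreover have "?N \<in> \<N>" using kernel_normal[OF W(1)] kernel_open[OF W(1)] W(1) by (auto simp: \<N>_def)
  ultimately show "\<exists>P\<in>?f ` \<N>. \<forall>p. exponent Q p \<le> exponent P p" by blast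
qed

section \<open>Restriction to an adapted set\<close>

text \<open>The carrier of the holonomy group in terms of \<open>A\<close>; \<open>restrict\<close>
  identifies elements that agree on \<open>U\<close>.\<close>

definition return_maps :: "'x set \<Rightarrow> ('x \<Rightarrow> 'x) set" where
  "return_maps U = (\<lambda>f. restrict f U) ` {f \<in> A. f ` U \<inter> U \<noteq> {}}"

lemma restrict_image: "W \<subseteq> U \<Longrightarrow> restrict f U ` W = f ` W"
  by (auto intro!: image_cong)

text \<open>A map whose image of \<open>W\<close> meets \<open>W\<close> also makes the image of
  \<open>U\<close> meet \<open>U\<close>, so it gives a return map and the block conditions agree.
  Relative and absolute clopenness agree since \<open>U\<close> is clopen.\<close>

lemma adapted_sets_restrict:
  assumes U: "U \<in> adapted_sets X A"
  shows "adapted_sets (subtopology X U) (return_maps U) = {W \<in> adapted_sets X A. W \<subseteq> U}"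
proof -
  have "block (return_maps U) W \<longleftrightarrow> block A W" if WU: "W \<subseteq> U" for W
  proof
    assume b: "block (return_maps U) W"
    show "block A W"
      unfolding block_def
    proof (intro ballI impI)
      fix f assume f: "f \<in> A" and ne: "f ` W \<inter> W \<noteq> {}"
      then have "f ` U \<inter> U \<noteq> {}" using WU by blast
      then have "restrict f U \<in> return_maps U" using f by (auto simp: return_maps_def)
      then have "restrict f U ` W \<inter> W \<noteq> {} \<longrightarrow> restrict f U ` W = W" using b unfolding block_def by blast
      then show "f ` W = W" using ne unfolding restrict_image[OF WU] by blast
    qed
  next
    assume "block A W"
    show "block (return_maps U) W"
      unfolding block_def
    proof (intro ballI impI)
      fix g assume "g \<in> return_maps U" and ne: "g ` W \<inter> W \<noteq> {}"
      then obtain f where f: "f \<in> A" "g = restrict f U" by (auto simp: return_maps_def)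
      show "g ` W = W"
        using ne \<open>block A W\<close> f(1) unfolding f(2) restrict_image[OF WU] block_def by blast
    qed
  qed
  then show ?thesis
    unfolding adapted_sets_def
    using openin_open_subtopology[OF adaptedD(2)[OF U]] closedin_closed_subtopology[OF adaptedD(3)[OF U]]
    by auto
qed

text \<open>A translate inside \<open>U\<close> comes from a return map, because a non-empty
  \<open>W\<close> makes the image of \<open>U\<close> meet \<open>U\<close>; conversely, return
  maps preserve \<open>U\<close>.\<close>

lemma translates_restrict:
  assumes W: "W \<subseteq> U" "W \<noteq> {}" and U: "U \<in> adapted_sets X A"
  shows "translates (return_maps U) W = {B \<in> translates A W. B \<subseteq> U}"
proof (intro subset_antisym subsetI)
  fix B assume "B \<in> translates (return_maps U) W"
  then obtain f where f: "f \<in> A" "f ` U \<inter> U \<noteq> {}" "B = f ` W"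
    unfolding translates_def return_maps_def image_image restrict_image[OF W(1)] by blast
  then have "f ` U = U" using adaptedD(4)[OF U] by (auto simp: block_def)
  then show "B \<in> {B \<in> translates A W. B \<subseteq> U}" using f W by (auto simp: translates_def)
next
  fix B assume "B \<in> {B \<in> translates A W. B \<subseteq> U}"
  then obtain f where f: "f \<in> A" "B = f ` W" "f ` W \<subseteq> U" by (auto simp: translates_def)
  then have "f ` U \<inter> U \<noteq> {}" using W by blast
  then have "restrict f U \<in> return_maps U" using f by (auto simp: return_maps_def)
  then show "B \<in> translates (return_maps U) W"
    unfolding translates_def
    by (rule image_eqI[rotated]) (simp only: f(2) restrict_image[OF W(1)])
qed

text \<open>Adapted subsets of \<open>U\<close> are cofinal: intersect \<open>U\<close> with a
  translate of \<open>W\<close> that meets it. Their indices all carry the factor contributed by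
  \<open>U\<close>, which comes out of the least common multiple.\<close>

lemma steinitz_index_restrict:
  assumes U: "U \<in> adapted_sets X A"
  shows "steinitz_index X A =
    steinitz_of_nat (card (translates A U)) * steinitz_index (subtopology X U) (return_maps U)"
proof -
  let ?c = "\<lambda>W. steinitz_of_nat (card (translates A W))"
  let ?T = "{W \<in> adapted_sets X A. W \<subseteq> U}"
  have mult: "?c W = ?c U * steinitz_of_nat (card (translates (return_maps U) W))" if W: "W \<in> ?T" for W
  proof -
    have W': "W \<in> adapted_sets X A" "W \<subseteq> U" using W by auto
    have "card (translates A W) = card (translates A U) * card (translates (return_maps U) W)"
      unfolding translates_restrict[OF W'(2) adaptedD(1)[OF W'(1)] U]
      by (rule card_translates_mult[OF adaptedD(5,4)[OF U] W'(2) adaptedD(1,4)[OF W'(1)] finite_translates[OF W'(1)]])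
    then show ?thesis
      using card_translates_pos[OF W'(1)] by (auto intro!: steinitz_of_nat_mult simp: Suc_le_eq)
  qed
  have "steinitz_index X A = steinitz_LCM (?c ` ?T)"
    unfolding steinitz_index_def
  proof (rule steinitz_LCM_eqI)
    fix P assume "P \<in> ?c ` adapted_sets X A"
    then obtain W where W: "W \<in> adapted_sets X A" "P = ?c W" by blast
    obtain x where x: "x \<in> U" using adaptedD(1)[OF U] by blast
    then have "x \<in> S" using adaptedD(5)[OF U] by blast
    then obtain B where B: "B \<in> translates A W" "x \<in> B" by (rule translates_cover[OF W(1)])
    have BA: "B \<in> adapted_sets X A" using adapted_translate[OF W(1) B(1)] .
    have "block A (B \<inter> U)"
      unfolding block_def
    proof (intro ballI impI)
      fix f assume f: "f \<in> A" and ne: "f ` (B \<inter> U) \<inter> (B \<inter> U) \<noteq> {}"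
      then have "f ` B = B" "f ` U = U"
        using adaptedD(4)[OF BA] adaptedD(4)[OF U] unfolding block_def by blast+
      \<comment> \<open>Injectivity of \<open>f\<close> lets the image commute with the
        intersection, so two blocks intersect in a block.\<close>
      moreover have "f ` (B \<inter> U) = f ` B \<inter> f ` U"
        by (rule inj_on_image_Int[of f S])
          (use bij[OF f] adaptedD(5)[OF BA] adaptedD(5)[OF U] in \<open>auto simp: bij_betw_def\<close>)
      ultimately show "f ` (B \<inter> U) = B \<inter> U" by simp
    qed
    then have BU: "B \<inter> U \<in> adapted_sets X A"
      using adaptedD(2,3)[OF BA] adaptedD(2,3)[OF U] B(2) x by (auto simp: adapted_sets_def)
    have "card (translates A W) dvd card (translates A (B \<inter> U))"
      using translates_dvd[OF BA BU] translates_translate[OF adaptedD(5)[OF W(1)] B(1)] by simp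
    then have "\<forall>p. exponent P p \<le> exponent (?c (B \<inter> U)) p"
      using exponent_of_nat_dvd_le card_translates_pos[OF BU] W(2) by blast
    then show "\<exists>Q\<in>?c ` ?T. \<forall>p. exponent P p \<le> exponent Q p" using BU by blast
  qed auto
  also have "?c ` ?T = (*) (?c U) ` (\<lambda>W. steinitz_of_nat (card (translates (return_maps U) W))) ` ?T"
    unfolding image_image by (rule image_cong[OF refl mult])
  also have "steinitz_LCM \<dots> = ?c U * steinitz_index (subtopology X U) (return_maps U)"
    unfolding steinitz_index_def adapted_sets_restrict[OF U]
    by (rule steinitz_LCM_of_nat_mult) (use U in auto)
  finally show ?thesis .
qed

end

section \<open>Transport along an isomorphism of actions\<close>

text \<open>Conjugation by \<open>h\<close> matches the maps in \<open>H1\<close> with those in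
  \<open>H2\<close>, so blocks go to blocks and \<open>h\<close> induces a bijection of their
  translates.\<close>

lemma adapted_card_transport:
  assumes hom: "homeomorphic_maps Y1 Y2 h h'"
    and H1: "\<And>f. f \<in> H1 \<Longrightarrow> f ` topspace Y1 \<subseteq> topspace Y1"
    and forward: "\<And>f. f \<in> H1 \<Longrightarrow> \<exists>g\<in>H2. \<forall>y\<in>topspace Y2. g y = h (f (h' y))"
    and backward: "\<And>g. g \<in> H2 \<Longrightarrow> \<exists>f\<in>H1. \<forall>y\<in>topspace Y2. g y = h (f (h' y))"
    and W: "W \<in> adapted_sets Y1 H1"
  shows "h ` W \<in> adapted_sets Y2 H2" "card (translates H2 (h ` W)) = card (translates H1 W)"
proof -
  have WY: "W \<subseteq> topspace Y1" using W openin_subset by (auto simp: adapted_sets_def)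
  have h: "homeomorphic_map Y1 Y2 h" using hom homeomorphic_maps_map by blast
  have h'h: "h' (h y) = y" "h y \<in> topspace Y2" if "y \<in> topspace Y1" for y
    using hom that by (auto simp: homeomorphic_maps_def continuous_map_def)
  have conj: "g ` h ` W = h ` f ` W" if "\<forall>y\<in>topspace Y2. g y = h (f (h' y))" for f g
    unfolding image_image by (rule image_cong) (use that WY h'h in auto)
  have inj: "inj_on h (topspace Y1)" using h'h by (metis inj_onI)
  have sub: "f ` W \<subseteq> topspace Y1" if "f \<in> H1" for f using H1[OF that] WY by blast
  have "block H2 (h ` W)"
    unfolding block_def
  proof (intro ballI impI)
    fix g assume g: "g \<in> H2" and ne: "g ` h ` W \<inter> h ` W \<noteq> {}"
    obtain f where f: "f \<in> H1" "\<forall>y\<in>topspace Y2. g y = h (f (h' y))" using backward[OF g] by blast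
    have "h ` f ` W \<inter> h ` W = h ` (f ` W \<inter> W)"
      by (rule inj_on_image_Int[OF inj sub[OF f(1)] WY, symmetric])
    then have "f ` W \<inter> W \<noteq> {}" using ne conj[OF f(2)] by auto
    then have "f ` W = W" using W f(1) unfolding adapted_sets_def block_def by blast
    then show "g ` h ` W = h ` W" unfolding conj[OF f(2)] by simp
  qed
  then show "h ` W \<in> adapted_sets Y2 H2"
    using W homeomorphic_map_openness[OF h WY] homeomorphic_map_closedness[OF h WY]
    by (auto simp: adapted_sets_def)
  have "translates H2 (h ` W) = (`) h ` translates H1 W"
  proof (intro subset_antisym subsetI)
    fix B assume "B \<in> translates H2 (h ` W)"
    then obtain g where g: "g \<in> H2" "B = g ` h ` W" by (auto simp: translates_def)
    obtain f where f: "f \<in> H1" "\<forall>y\<in>topspace Y2. g y = h (f (h' y))" using backward[OF g(1)] by blast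
    show "B \<in> (`) h ` translates H1 W" unfolding g(2) conj[OF f(2)] using f(1) by (auto simp: translates_def)
  next
    fix B assume "B \<in> (`) h ` translates H1 W"
    then obtain f where f: "f \<in> H1" "B = h ` f ` W" by (auto simp: translates_def)
    obtain g where g: "g \<in> H2" "\<forall>y\<in>topspace Y2. g y = h (f (h' y))" using forward[OF f(1)] by blast
    show "B \<in> translates H2 (h ` W)" unfolding f(2) conj[OF g(2), symmetric] using g(1) by (auto simp: translates_def)
  qed
  moreover have "inj_on ((`) h) (translates H1 W)"
    using inj_on_image_eq_iff[OF inj] sub by (auto simp: inj_on_def translates_def)
  ultimately show "card (translates H2 (h ` W)) = card (translates H1 W)" by (simp add: card_image)
qed

lemma steinitz_index_transport:
  assumes hom: "homeomorphic_maps Y1 Y2 h h'"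
    and H1: "\<And>f. f \<in> H1 \<Longrightarrow> f ` topspace Y1 \<subseteq> topspace Y1"
    and H2: "\<And>g. g \<in> H2 \<Longrightarrow> g ` topspace Y2 \<subseteq> topspace Y2"
    and forward: "\<And>f. f \<in> H1 \<Longrightarrow> \<exists>g\<in>H2. \<forall>y\<in>topspace Y1. f y = h' (g (h y))"
    and backward: "\<And>g. g \<in> H2 \<Longrightarrow> \<exists>f\<in>H1. \<forall>y\<in>topspace Y1. f y = h' (g (h y))"
  shows "steinitz_index Y1 H1 = steinitz_index Y2 H2"
proof -
  have maps: "h y \<in> topspace Y2" "h' (h y) = y" if "y \<in> topspace Y1" for y
    using hom that by (auto simp: homeomorphic_maps_def continuous_map_def)
  have maps': "h' y \<in> topspace Y1" "h (h' y) = y" if "y \<in> topspace Y2" for y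
    using hom that by (auto simp: homeomorphic_maps_def continuous_map_def)
  \<comment> \<open>Puts the correspondence into the form for transport from \<open>Y1\<close> to
    \<open>Y2\<close>; the given form serves the opposite direction. The values of \<open>g\<close>
    must stay in \<open>Y2\<close> for \<open>h\<close> and \<open>h'\<close> to cancel.\<close>
  have inverse: "\<forall>y\<in>topspace Y2. g y = h (f (h' y))"
    if "g \<in> H2" "\<forall>y\<in>topspace Y1. f y = h' (g (h y))" for f g
  proof
    fix y assume y: "y \<in> topspace Y2"
    have "g y \<in> topspace Y2" using H2[OF that(1)] y by blast
    then show "g y = h (f (h' y))" using that(2) maps'[OF y] maps' by simp
  qed
  have forward2: "\<exists>g\<in>H2. \<forall>y\<in>topspace Y2. g y = h (f (h' y))" if "f \<in> H1" for f
    using forward[OF that] inverse by blast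
  have backward2: "\<exists>f\<in>H1. \<forall>y\<in>topspace Y2. g y = h (f (h' y))" if "g \<in> H2" for g
    using backward[OF that] inverse[OF that] by blast
  note transport1 = adapted_card_transport[OF hom H1 forward2 backward2]
  note transport2 = adapted_card_transport[OF hom[THEN homeomorphic_maps_sym[THEN iffD1]] H2 backward forward]
  show ?thesis
    unfolding steinitz_index_def
  proof (rule arg_cong[where f = steinitz_LCM], intro subset_antisym image_subsetI)
    fix W assume "W \<in> adapted_sets Y1 H1"
    then show "steinitz_of_nat (card (translates H1 W))
        \<in> (\<lambda>W. steinitz_of_nat (card (translates H2 W))) ` adapted_sets Y2 H2"
      using transport1[of W] by (intro image_eqI[of _ _ "h ` W"]) auto
  next
    fix W assume "W \<in> adapted_sets Y2 H2"
    then show "steinitz_of_nat (card (translates H2 W))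
        \<in> (\<lambda>W. steinitz_of_nat (card (translates H1 W))) ` adapted_sets Y1 H1"
      using transport2[of W] by (intro image_eqI[of _ _ "h' ` W"]) auto
  qed
qed


section \<open>The uniform topology\<close>

text \<open>A Lebesgue number for the cover by \<open>C\<close> and its complement, then the minimum
  over the finitely many \<open>C\<close>.\<close>

lemma clopen_uniform:
  assumes e: "mtopology_of e = X" and X: "compact_space X"
    and Q: "finite Q" "\<And>C. C \<in> Q \<Longrightarrow> openin X C \<and> closedin X C"
  shows "\<exists>\<epsilon>>0. \<forall>y\<in>topspace X. \<forall>z\<in>topspace X. mdist e y z < \<epsilon> \<longrightarrow> (\<forall>C\<in>Q. y \<in> C \<longleftrightarrow> z \<in> C)"
  using Q
proof (induction Q rule: finite_induct)
  case empty
  show ?case by (intro exI[of _ 1]) simp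
next
  case (insert C Q)
  interpret M: Metric_space "mspace e" "mdist e" by (rule Metric_space_mspace_mdist)
  have X_eq: "X = M.mtopology" using e by (simp add: mtopology_of_def)
  have S: "topspace X = mspace e" unfolding X_eq by simp
  have C: "openin X C" "openin X (topspace X - C)" using insert.prems[of C] by auto
  have "\<exists>\<epsilon>>0. \<forall>y\<in>topspace X. \<exists>U\<in>{C, topspace X - C}. M.mball y \<epsilon> \<subseteq> U"
    by (rule M.lebesgue_number) (use X C in \<open>auto simp: X_eq compact_space_def\<close>)
  then obtain \<epsilon> where \<epsilon>: "\<epsilon> > 0" "\<And>y. y \<in> topspace X \<Longrightarrow> M.mball y \<epsilon> \<subseteq> C \<or> M.mball y \<epsilon> \<subseteq> topspace X - C"
    by blast
  obtain \<delta> where \<delta>: "\<delta> > 0"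
    "\<forall>y\<in>topspace X. \<forall>z\<in>topspace X. mdist e y z < \<delta> \<longrightarrow> (\<forall>C\<in>Q. y \<in> C \<longleftrightarrow> z \<in> C)"
    using insert.IH[OF insert.prems[OF insertI2]] by auto
  show ?case
  proof (intro exI[of _ "min \<epsilon> \<delta>"] conjI ballI impI)
    fix y z D assume yz: "y \<in> topspace X" "z \<in> topspace X" "mdist e y z < min \<epsilon> \<delta>" and D: "D \<in> insert C Q"
    have "y \<in> M.mball y \<epsilon>" "z \<in> M.mball y \<epsilon>" using yz \<epsilon>(1) by (auto simp: S)
    then have "y \<in> C \<longleftrightarrow> z \<in> C" using \<epsilon>(2)[OF yz(1)] by blast
    moreover have "mdist e y z < \<delta>" using yz(3) by simp
    then have "\<forall>C\<in>Q. y \<in> C \<longleftrightarrow> z \<in> C" using \<delta>(2) yz(1,2) by blast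
    ultimately show "y \<in> D \<longleftrightarrow> z \<in> D" using D by blast
  qed (use \<epsilon> \<delta> in simp)
qed

text \<open>A basic open set of the product constrains finitely many coordinates, and its factors
  are discrete, so it is also closed; its preimage is the desired clopen set.\<close>

lemma cantor_space_clopen_base:
  assumes "cantor_space X" "openin X V" "x \<in> V"
  shows "\<exists>C. openin X C \<and> closedin X C \<and> x \<in> C \<and> C \<subseteq> V"
proof -
  let ?T = "product_topology (\<lambda>_::nat. discrete_topology (UNIV :: bool set)) UNIV"
  obtain h h' where hom: "homeomorphic_maps X ?T h h'"
    using assms(1) unfolding cantor_space_def homeomorphic_space_def by blast
  then have h: "homeomorphic_map X ?T h" using homeomorphic_maps_map by blast
  have x: "x \<in> topspace X" using assms openin_subset by blast
  have "openin ?T (h ` V)" using homeomorphic_map_openness_eq[OF h] assms(2) by blast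
  then obtain U where U: "finite {i \<in> (UNIV::nat set). U i \<noteq> topspace (discrete_topology (UNIV :: bool set))}"
    "h x \<in> Pi\<^sub>E UNIV U" "Pi\<^sub>E UNIV U \<subseteq> h ` V"
    unfolding openin_product_topology_alt using assms(3) by blast
  let ?C = "{y \<in> topspace X. h y \<in> Pi\<^sub>E UNIV U}"
  have "openin ?T (Pi\<^sub>E UNIV U)" unfolding openin_PiE_gen using U(1) by simp
  then have "openin X ?C" using openin_continuous_map_preimage homeomorphic_imp_continuous_map[OF h] by blast
  moreover have "closedin ?T (Pi\<^sub>E UNIV U)" by (simp add: closedin_product_topology)
  then have "closedin X ?C" using closedin_continuous_map_preimage homeomorphic_imp_continuous_map[OF h] by blast
  moreover have "?C \<subseteq> V"
  proof
    fix y assume y: "y \<in> ?C"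
    then obtain v where v: "v \<in> V" "h y = h v" using U(3) by blast
    moreover have "v \<in> topspace X" using v assms(2) openin_subset by blast
    ultimately show "y \<in> V"
      using y hom by (metis (no_types, lifting) homeomorphic_maps_def mem_Collect_eq)
  qed
  ultimately show ?thesis using x U(2) by blast
qed

lemma cantor_space_compact_Hausdorff:
  assumes "cantor_space X"
  shows "compact_space X" "Hausdorff_space X" "topspace X \<noteq> {}"
proof -
  let ?T = "product_topology (\<lambda>_::nat. discrete_topology (UNIV :: bool set)) UNIV"
  have hom: "X homeomorphic_space ?T" using assms by (simp add: cantor_space_def)
  have "compact_space ?T" by (simp add: compact_space_product_topology compact_space_discrete_topology)
  then show "compact_space X" using homeomorphic_compact_space[OF hom] by simp
  have "Hausdorff_space ?T" by (simp add: Hausdorff_space_product_topology)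
  then show "Hausdorff_space X" using homeomorphic_Hausdorff_space[OF hom] by simp
  have "topspace ?T \<noteq> {}" by simp
  then show "topspace X \<noteq> {}"
    using hom by (metis homeomorphic_empty_space null_topspace_iff_trivial)
qed

text \<open>The metric \<open>e\<close> provided by \<open>equicontinuous\<close> may differ from
  the one defining the uniform topology. Points closer than \<open>\<epsilon>\<close> agree on
  membership in \<open>C\<close>, and the ball of the matching radius \<open>\<delta>\<close> is the
  required neighbourhood.\<close>

lemma equicontinuous_system_action:
  assumes act: "cantor_action G X \<Phi>" and equi: "equicontinuous G X \<Phi>"
  shows "equicontinuous_system X (\<Phi> ` carrier G)"
proof -
  have cs: "cantor_space X" using act by (simp add: cantor_action_def)
  note top = cantor_space_compact_Hausdorff[OF cs]
  have ga: "group_action G (topspace X) \<Phi>" using act by (simp add: cantor_action_def)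
  then interpret group_hom G "BijGroup (topspace X)" \<Phi> by (simp add: group_action_def)
  show ?thesis
  proof (intro equicontinuous_system.intro transformation_group.intro equicontinuous_system_axioms.intro)
    show "subgroup (\<Phi> ` carrier G) (BijGroup (topspace X))" by (rule img_is_subgroup)
    show "topspace X \<noteq> {}" "compact_space X" "Hausdorff_space X" using top by auto
    show "\<exists>C. openin X C \<and> closedin X C \<and> x \<in> C \<and> C \<subseteq> V" if "openin X V" "x \<in> V" for V x
      using cantor_space_clopen_base[OF cs that] .
    show "continuous_map X X f" if "f \<in> \<Phi> ` carrier G" for f
      using that act homeomorphic_imp_continuous_map by (auto simp: cantor_action_def)
    show "\<exists>f\<in>\<Phi> ` carrier G. f x \<in> V" if V: "openin X V" "V \<noteq> {}" and x: "x \<in> topspace X" for V x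
    proof -
      obtain v where v: "v \<in> V" using V by blast
      then have "v \<in> X closure_of orbit G \<Phi> x"
        using act x V openin_subset by (auto simp: cantor_action_def)
      then obtain y where "y \<in> orbit G \<Phi> x" "y \<in> V"
        using v V(1) unfolding in_closure_of by blast
      then show ?thesis by (auto simp: orbit_def)
    qed
    show "\<exists>V. openin X V \<and> x \<in> V \<and> (\<forall>y\<in>V. \<forall>f\<in>\<Phi> ` carrier G. f y \<in> C \<longleftrightarrow> f x \<in> C)"
      if C: "openin X C" "closedin X C" and x: "x \<in> topspace X" for C x
    proof -
      obtain e where e: "mtopology_of e = X"
        "\<And>\<epsilon>. \<epsilon> > 0 \<Longrightarrow> \<exists>\<delta>>0. \<forall>x\<in>topspace X. \<forall>y\<in>topspace X. mdist e x y < \<delta> \<longrightarrow>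
          (\<forall>g\<in>carrier G. mdist e (\<Phi> g x) (\<Phi> g y) < \<epsilon>)"
        using equi unfolding equicontinuous_def by blast
      interpret M: Metric_space "mspace e" "mdist e" by (rule Metric_space_mspace_mdist)
      have X_eq: "X = M.mtopology" using e(1) by (simp add: mtopology_of_def)
      obtain \<epsilon> where \<epsilon>: "\<epsilon> > 0" "\<And>y z. y \<in> topspace X \<Longrightarrow> z \<in> topspace X \<Longrightarrow> mdist e y z < \<epsilon> \<Longrightarrow> y \<in> C \<longleftrightarrow> z \<in> C"
        using clopen_uniform[OF e(1) top(1), of "{C}"] C by blast
      obtain \<delta> where \<delta>: "\<delta> > 0" "\<And>y z g. y \<in> topspace X \<Longrightarrow> z \<in> topspace X \<Longrightarrow> mdist e y z < \<delta> \<Longrightarrow>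
          g \<in> carrier G \<Longrightarrow> mdist e (\<Phi> g y) (\<Phi> g z) < \<epsilon>"
        using e(2)[OF \<epsilon>(1)] by blast
      show ?thesis
      proof (intro exI conjI ballI)
        show "openin X (M.mball x \<delta>)" unfolding X_eq by (rule M.openin_mball)
        show "x \<in> M.mball x \<delta>" using x \<delta>(1) by (simp add: X_eq)
        fix y f assume y: "y \<in> M.mball x \<delta>" and f: "f \<in> \<Phi> ` carrier G"
        then obtain g where g: "g \<in> carrier G" "f = \<Phi> g" by blast
        have yS: "y \<in> topspace X" using y by (simp add: X_eq)
        have "f x \<in> topspace X" "f y \<in> topspace X"
          using group_action.element_image[OF ga g(1)] x yS g(2) by blast+
        moreover have "mdist e (f x) (f y) < \<epsilon>" using \<delta>(2)[OF x yS _ g(1)] y g(2) by simp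
        ultimately show "f y \<in> C \<longleftrightarrow> f x \<in> C" using \<epsilon>(2) by blast
      qed
    qed
  qed
qed

section \<open>Closeness versus the supremum metric\<close>

context equicontinuous_system
begin

lemma mspace_cfunspace_Bij:
  assumes d: "mtopology_of d = X" and f: "f \<in> Bij S" "continuous_map X X f"
  shows "f \<in> mspace (cfunspace X d)"
proof -
  have "mspace d = S" using d topspace_mtopology_of by metis
  moreover have "compactin X S" using compact by (simp add: compact_space_def)
  ultimately show ?thesis
    unfolding compactin_mspace_cfunspace[OF \<open>compactin X S\<close>]
    using f d by (auto simp: Bij_def bij_betw_def)
qed

text \<open>Distinct translates of \<open>W\<close> are uniformly separated, so maps at small
  distance cannot send a point into different ones.\<close>

lemma close_if_dist:
  assumes d: "mtopology_of d = X" and W: "W \<in> adapted_sets X A"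
  obtains \<epsilon> where "\<epsilon> > 0"
    "\<And>f g. f \<in> mspace (cfunspace X d) \<Longrightarrow> g \<in> mspace (cfunspace X d) \<Longrightarrow>
       mdist (cfunspace X d) f g < \<epsilon> \<Longrightarrow> close W f g"
proof -
  have clopen: "openin X C \<and> closedin X C" if "C \<in> translates A W" for C
    using adaptedD(2,3)[OF adapted_translate[OF W that]] by blast
  obtain \<epsilon> where \<epsilon>: "\<epsilon> > 0" "\<forall>y\<in>S. \<forall>z\<in>S. mdist d y z < \<epsilon> \<longrightarrow>
      (\<forall>C\<in>translates A W. y \<in> C \<longleftrightarrow> z \<in> C)"
    using clopen_uniform[OF d compact finite_translates[OF W] clopen] by auto
  have dS: "mspace d = S" using d topspace_mtopology_of by metis
  have "close W f g" if fg: "f \<in> mspace (cfunspace X d)" "g \<in> mspace (cfunspace X d)"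
    "mdist (cfunspace X d) f g < \<epsilon>" for f g
    unfolding close_def
  proof (rule ballI)
    fix x assume x: "x \<in> S"
    have "mdist d (f x) (g x) \<le> mdist (cfunspace X d) f g"
      by (rule mdist_cfunspace_imp_mdist_le[OF fg(1,2) order_refl x])
    then have "mdist d (f x) (g x) < \<epsilon>" using fg(3) by simp
    moreover have "f x \<in> S" "g x \<in> S" using fg(1,2) x dS by auto
    ultimately show "\<forall>B\<in>translates A W. f x \<in> B \<longleftrightarrow> g x \<in> B" using \<epsilon>(2) by blast
  qed
  then show ?thesis using that \<epsilon>(1) by blast
qed

text \<open>Cover \<open>S\<close> by finitely many small clopen sets and choose \<open>W\<close> so
  that each of its translates lies inside one of them.\<close>

lemma dist_if_close:
  assumes d: "mtopology_of d = X" and "\<epsilon> > 0"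
  obtains W where "W \<in> adapted_sets X A"
    "\<And>f g. f \<in> Bij S \<Longrightarrow> g \<in> Bij S \<Longrightarrow> close W f g \<Longrightarrow> mdist (cfunspace X d) f g < \<epsilon>"
proof -
  interpret M: Metric_space "mspace d" "mdist d" by (rule Metric_space_mspace_mdist)
  have X_eq: "X = M.mtopology" using d by (simp add: mtopology_of_def)
  have dS: "mspace d = S" using d topspace_mtopology_of by metis
  have "\<exists>C. openin X C \<and> closedin X C \<and> x \<in> C \<and> C \<subseteq> M.mball x (\<epsilon>/4)" if "x \<in> S" for x
  proof (rule clopen_base)
    show "openin X (M.mball x (\<epsilon>/4))" unfolding X_eq by (rule M.openin_mball)
    have "x \<in> mspace d" using that unfolding dS .
    then show "x \<in> M.mball x (\<epsilon>/4)" using \<open>\<epsilon> > 0\<close> by simp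
  qed
  then obtain c where c: "\<And>x. x \<in> S \<Longrightarrow> openin X (c x) \<and> closedin X (c x) \<and> x \<in> c x \<and> c x \<subseteq> M.mball x (\<epsilon>/4)"
    by metis
  then have "(\<forall>U\<in>c ` S. openin X U) \<and> S \<subseteq> \<Union>(c ` S)" by blast
  then obtain Q where Q: "finite Q" "Q \<subseteq> c ` S" "S \<subseteq> \<Union>Q"
    using compact unfolding compact_space_alt by meson
  obtain x0 where x0: "x0 \<in> S" using nonempty by blast
  obtain W where W: "W \<in> adapted_sets X A"
    and ref: "\<And>B C. B \<in> translates A W \<Longrightarrow> C \<in> Q \<Longrightarrow> B \<subseteq> C \<or> B \<inter> C = {}"
    by (rule adapted_refinement[OF Q(1) _ x0]) (use Q(2) c in blast)+
  have "mdist (cfunspace X d) f g < \<epsilon>" if fg: "f \<in> Bij S" "g \<in> Bij S" "close W f g" for f g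
  proof -
    \<comment> \<open>Both values lie in one ball of radius \<open>\<epsilon>/4\<close>; the
      supremum is then at most \<open>\<epsilon>/2\<close>, strictly below
      \<open>\<epsilon>\<close>.\<close>
    have "mdist d (f x) (g x) \<le> \<epsilon>/2" if x: "x \<in> S" for x
    proof -
      have fx: "f x \<in> S" using fg(1) x by (auto dest: Bij_imp_funcset)
      obtain B where B: "B \<in> translates A W" "f x \<in> B" by (rule translates_cover[OF W fx])
      then have gB: "g x \<in> B" using closeD[OF fg(3) B(1) x] by simp
      obtain C where C: "C \<in> Q" "f x \<in> C" using Q(3) fx by blast
      then have "g x \<in> C" using ref[OF B(1) C(1)] B(2) gB by blast
      moreover obtain y where y: "y \<in> S" "C = c y" using Q(2) C(1) by blast
      ultimately have "f x \<in> M.mball y (\<epsilon>/4)" "g x \<in> M.mball y (\<epsilon>/4)" using c C(2) by blast+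
      then show ?thesis
        using M.triangle[of "f x" y "g x"] M.commute[of "f x" y] by auto
    qed
    then have "mdist (cfunspace X d) f g \<le> \<epsilon>/2"
      by (intro mdist_cfunspace_le) (use \<open>\<epsilon> > 0\<close> in auto)
    then show ?thesis using \<open>\<epsilon> > 0\<close> by simp
  qed
  then show ?thesis using that W by blast
qed

lemma return_maps_image:
  assumes U: "U \<in> adapted_sets X A" and f: "f \<in> return_maps U"
  shows "f ` topspace (subtopology X U) \<subseteq> topspace (subtopology X U)"
proof -
  obtain g where g: "g \<in> A" "g ` U \<inter> U \<noteq> {}" "f = restrict g U"
    using f by (auto simp: return_maps_def)
  then have "g ` U = U" using adaptedD(4)[OF U] by (auto simp: block_def)
  then show ?thesis
    unfolding topspace_subtopology_subset[OF adaptedD(5)[OF U]] g(3) restrict_image[OF subset_refl]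
    by simp
qed

lemma carrier_homeo_group: "carrier (homeo_group X) = {f \<in> Bij S. homeomorphic_map X X f}"
  by (simp add: homeo_group_def)

lemma completion_homeo: "completion \<subseteq> carrier (homeo_group X)"
proof
  fix f assume f: "f \<in> completion"
  have "homeomorphic_map X X f"
    by (rule continuous_imp_homeomorphic_map[OF completion_continuous[OF f] compact Hausdorff])
      (use C.bij[OF f] in \<open>auto simp: bij_betw_def\<close>)
  then show "f \<in> carrier (homeo_group X)" using completion_Bij[OF f] by (simp add: carrier_homeo_group)
qed

lemma homeo_mspace:
  assumes "mtopology_of d = X" "f \<in> carrier (homeo_group X)"
  shows "f \<in> mspace (cfunspace X d)"
  using assms(2) mspace_cfunspace_Bij[OF assms(1)] homeomorphic_imp_continuous_map
  unfolding carrier_homeo_group by blast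

text \<open>The two comparisons of closeness with distance give the two inclusions. As
  \<open>completion\<close> does not mention \<open>d\<close>, the closure is the same for every
  compatible metric.\<close>

lemma closure_eq_completion:
  assumes d: "mtopology_of d = X"
  shows "uniform_topology X d closure_of A = completion"
proof -
  let ?E = "cfunspace X d"
  interpret E: Metric_space "mspace ?E" "mdist ?E" by (rule Metric_space_mspace_mdist)
  have A: "A \<subseteq> carrier (homeo_group X)" using subset_completion completion_homeo by blast
  have "uniform_topology X d closure_of A = carrier (homeo_group X) \<inter> (E.mtopology closure_of A)"
    unfolding uniform_topology_def closure_of_subtopology using A
    by (simp add: mtopology_of_def Int_absorb1)
  also have "\<dots> = completion"
  proof (intro subset_antisym subsetI)
    fix f assume f: "f \<in> carrier (homeo_group X) \<inter> (E.mtopology closure_of A)"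
    have "\<exists>g\<in>A. close W f g" if W: "W \<in> adapted_sets X A" for W
    proof -
      obtain \<epsilon> where \<epsilon>: "\<epsilon> > 0" "\<And>f g. f \<in> mspace ?E \<Longrightarrow> g \<in> mspace ?E \<Longrightarrow> mdist ?E f g < \<epsilon> \<Longrightarrow> close W f g"
        by (rule close_if_dist[OF d W]) blast
      obtain g where g: "g \<in> A" "g \<in> E.mball f \<epsilon>" using f \<epsilon>(1) unfolding E.metric_closure_of by blast
      then show ?thesis using \<epsilon>(2) unfolding E.in_mball by blast
    qed
    then show "f \<in> completion" using f by (auto simp: completion_def carrier_homeo_group)
  next
    fix f assume f: "f \<in> completion"
    have fE: "f \<in> mspace ?E" using homeo_mspace[OF d] completion_homeo f by blast
    have "\<exists>g\<in>A. g \<in> E.mball f r" if r: "r > 0" for r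
    proof -
      obtain W where W: "W \<in> adapted_sets X A"
        "\<And>f g. f \<in> Bij S \<Longrightarrow> g \<in> Bij S \<Longrightarrow> close W f g \<Longrightarrow> mdist ?E f g < r"
        by (rule dist_if_close[OF d r]) blast
      obtain g where g: "g \<in> A" "close W f g" by (rule completion_close[OF f W(1)])
      then have "mdist ?E f g < r" using W(2) completion_Bij[OF f] subset_Bij by blast
      moreover have "g \<in> mspace ?E" using homeo_mspace[OF d] A g by blast
      ultimately show ?thesis using g fE by (auto simp del: mspace_cfunspace)
    qed
    then show "f \<in> carrier (homeo_group X) \<inter> (E.mtopology closure_of A)"
      unfolding E.metric_closure_of using fE completion_homeo f by blast
  qed
  finally show ?thesis .
qed

text \<open>For a subgroup a neighbourhood of the identity suffices: a ball around the identity
  yields one \<open>W\<close>, and left translation spreads it over \<open>N\<close>. Conversely,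
  balls of one common radius around the elements of \<open>N\<close> exhibit \<open>N\<close> as
  open.\<close>

lemma openin_uniform_topology_iff:
  assumes d: "mtopology_of d = X" and N: "subgroup N ((BijGroup S)\<lparr>carrier := completion\<rparr>)"
  shows "openin (subtopology (uniform_topology X d) completion) N \<longleftrightarrow>
    (\<exists>W\<in>adapted_sets X A. open_in_completion N W)"
proof -
  let ?E = "cfunspace X d"
  interpret E: Metric_space "mspace ?E" "mdist ?E" by (rule Metric_space_mspace_mdist)
  interpret N: transformation_group S N by (rule C.subgroup_transformation_group[OF N])
  have NK: "N \<subseteq> completion" using subgroup.subset[OF N] by simp
  have KE: "completion \<subseteq> mspace ?E" using homeo_mspace[OF d] completion_homeo by blast
  have "subtopology (uniform_topology X d) completion = subtopology E.mtopology completion"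
    unfolding uniform_topology_def subtopology_subtopology mtopology_of_def
    using completion_homeo by (simp add: Int_absorb1)
  moreover have "openin (subtopology E.mtopology completion) N \<longleftrightarrow>
    (\<exists>W\<in>adapted_sets X A. open_in_completion N W)"
  proof
    assume "openin (subtopology E.mtopology completion) N"
    then obtain U where U: "openin E.mtopology U" "N = U \<inter> completion" unfolding openin_subtopology by blast
    obtain e where e: "e \<in> N" "\<And>y. y \<in> S \<Longrightarrow> e y = y" by (rule N.one_ex) blast
    then obtain r where r: "r > 0" "E.mball e r \<subseteq> U" using U unfolding E.openin_mtopology by blast
    obtain W where W: "W \<in> adapted_sets X A"
      "\<And>f g. f \<in> Bij S \<Longrightarrow> g \<in> Bij S \<Longrightarrow> close W f g \<Longrightarrow> mdist ?E f g < r"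
      by (rule dist_if_close[OF d r(1)]) blast
    have "open_in_completion N W"
      unfolding open_in_completion_def
    proof (intro ballI impI)
      fix n k assume n: "n \<in> N" and k: "k \<in> completion" and cl: "close W k n"
      have nK: "n \<in> completion" using n NK by blast
      obtain m where m: "m \<in> completion" "\<And>y. y \<in> S \<Longrightarrow> k y = n (m y)" "close W m (\<lambda>y. y)"
        by (rule close_quotient[OF W(1) nK k close_sym[OF cl]]) blast
      have "close W e m" using m(3) e(2) by (simp add: close_def)
      then have "mdist ?E e m < r" using W(2) completion_Bij NK e(1) m(1) by blast
      then have "m \<in> E.mball e r" using KE NK e(1) m(1) by (auto simp del: mspace_cfunspace)
      then have "m \<in> N" using r(2) U(2) m(1) by blast
      moreover have "k = compose S n m"
        by (rule extensionalityI[OF C.ext_on[OF k] compose_extensional]) (simp add: compose_eq m(2))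
      ultimately show "k \<in> N" using N.compose_closed[OF n] by simp
    qed
    then show "\<exists>W\<in>adapted_sets X A. open_in_completion N W" using W(1) by blast
  next
    assume "\<exists>W\<in>adapted_sets X A. open_in_completion N W"
    then obtain W where W: "W \<in> adapted_sets X A" "open_in_completion N W" by blast
    obtain \<epsilon> where \<epsilon>: "\<epsilon> > 0" "\<And>f g. f \<in> mspace ?E \<Longrightarrow> g \<in> mspace ?E \<Longrightarrow> mdist ?E f g < \<epsilon> \<Longrightarrow> close W f g"
      by (rule close_if_dist[OF d W(1)]) blast
    let ?U = "\<Union>n\<in>N. E.mball n \<epsilon>"
    have "openin E.mtopology ?U" by blast
    moreover have "N = ?U \<inter> completion"
    proof (intro subset_antisym subsetI)
      fix n assume n: "n \<in> N"
      then have "n \<in> E.mball n \<epsilon>" using NK KE \<epsilon>(1) E.centre_in_mball_iff by blast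
      then show "n \<in> ?U \<inter> completion" using n NK by blast
    next
      fix k assume "k \<in> ?U \<inter> completion"
      then obtain n where n: "n \<in> N" "k \<in> E.mball n \<epsilon>" "k \<in> completion" by blast
      then have "close W n k" using \<epsilon>(2) by (auto simp del: mspace_cfunspace)
      then show "k \<in> N" using W(2) n close_sym unfolding open_in_completion_def by blast
    qed
    ultimately show "openin (subtopology E.mtopology completion) N" unfolding openin_subtopology by blast
  qed
  ultimately show ?thesis by simp
qed

end

section \<open>The relative Steinitz order as an index, and its invariance\<close>

text \<open>The index involves neither \<open>d\<close> nor \<open>x\<close>, so independence of the
  metric and of the base point is included.\<close>

lemma rel_steinitz_order_eq_index:
  assumes "cantor_action G X \<Phi>" "equicontinuous G X \<Phi>" and d: "mtopology_of d = X"
    and x: "x \<in> topspace X"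
  shows "rel_steinitz_order G X d \<Phi> x = steinitz_index X (\<Phi> ` carrier G)"
proof -
  interpret equicontinuous_system X "\<Phi> ` carrier G"
    by (rule equicontinuous_system_action[OF assms(1,2)])
  let ?K = "(BijGroup S)\<lparr>carrier := completion\<rparr>"
  have K: "closure_group G X d \<Phi> = ?K"
    using closure_eq_completion[OF d] by (simp add: closure_group_def homeo_group_def)
  have N: "open_normal_subgroups G X d \<Phi> =
    {N. N \<lhd> ?K \<and> (\<exists>W\<in>adapted_sets X (\<Phi> ` carrier G). open_in_completion N W)}"
    unfolding open_normal_subgroups_def K
    using openin_uniform_topology_iff[OF d normal_imp_subgroup] by auto
  have "rel_steinitz_order G X d \<Phi> x =
    steinitz_LCM ((\<lambda>N. steinitz_of_nat (card (translates completion ((\<lambda>n. n x) ` N)))) `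
      open_normal_subgroups G X d \<Phi>)"
    unfolding rel_steinitz_order_def Let_def isotropy_group_def K
  proof (intro arg_cong[where f = steinitz_LCM] image_cong refl)
    fix M assume "M \<in> open_normal_subgroups G X d \<Phi>"
    then have "M \<lhd> ?K" unfolding N by blast
    from C.card_lcosets[OF this x]
    show "steinitz_of_nat (card (lcosets\<^bsub>?K\<^esub> (M <#>\<^bsub>?K\<^esub> stabilizer ?K (\<lambda>g. g) x)))
      = steinitz_of_nat (card (translates completion ((\<lambda>n. n x) ` M)))"
      by (rule arg_cong)
  qed
  then show ?thesis unfolding N using steinitz_index_eq_LCM[OF x] by simp
qed

lemma holonomy_group_carrier:
  assumes "cantor_action G X \<Phi>" "equicontinuous G X \<Phi>"
  shows "carrier (holonomy_group G X \<Phi> U) =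
    equicontinuous_system.return_maps (\<Phi> ` carrier G) U"
proof -
  interpret equicontinuous_system X "\<Phi> ` carrier G"
    by (rule equicontinuous_system_action[OF assms])
  show ?thesis
    by (auto simp: holonomy_group_def return_set_def return_maps_def)
qed

theorem theorem1p7:
  fixes G1 :: "('g1, 'm1) monoid_scheme" and X1 :: "'x1 topology"
    and \<Phi>1 :: "'g1 \<Rightarrow> 'x1 \<Rightarrow> 'x1" and d1 :: "'x1 metric" and x1 :: 'x1
    and G2 :: "('g2, 'm2) monoid_scheme" and X2 :: "'x2 topology"
    and \<Phi>2 :: "'g2 \<Rightarrow> 'x2 \<Rightarrow> 'x2" and d2 :: "'x2 metric" and x2 :: 'x2
  assumes "cantor_action G1 X1 \<Phi>1" "equicontinuous G1 X1 \<Phi>1"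
    and "cantor_action G2 X2 \<Phi>2" "equicontinuous G2 X2 \<Phi>2"
    and "return_equivalent G1 X1 \<Phi>1 G2 X2 \<Phi>2"
    and "mtopology_of d1 = X1" "mtopology_of d2 = X2"
    and "x1 \<in> topspace X1" "x2 \<in> topspace X2"
  shows "rel_asymp_steinitz_order G1 X1 d1 \<Phi>1 x1 = rel_asymp_steinitz_order G2 X2 d2 \<Phi>2 x2"
proof -
  interpret A1: equicontinuous_system X1 "\<Phi>1 ` carrier G1"
    by (rule equicontinuous_system_action[OF assms(1,2)])
  interpret A2: equicontinuous_system X2 "\<Phi>2 ` carrier G2"
    by (rule equicontinuous_system_action[OF assms(3,4)])
  obtain U1 U2 where U: "adapted G1 X1 \<Phi>1 U1" "adapted G2 X2 \<Phi>2 U2"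
    and iso: "isomorphic_actions
      (holonomy_group G1 X1 \<Phi>1 U1) (subtopology X1 U1) (\<lambda>g. g)
      (holonomy_group G2 X2 \<Phi>2 U2) (subtopology X2 U2) (\<lambda>g. g)"
    using assms(5) unfolding return_equivalent_def by blast
  let ?H1 = "A1.return_maps U1" and ?H2 = "A2.return_maps U2"
  have U1: "U1 \<in> adapted_sets X1 (\<Phi>1 ` carrier G1)" and U2: "U2 \<in> adapted_sets X2 (\<Phi>2 ` carrier G2)"
    using U by (auto simp: adapted_def adapted_sets_def block_def)
  note car1 = holonomy_group_carrier[OF assms(1,2), of U1]
    and car2 = holonomy_group_carrier[OF assms(3,4), of U2]
  obtain h h' \<Theta> where h: "homeomorphic_maps (subtopology X1 U1) (subtopology X2 U2) h h'"
    and \<Theta>: "\<Theta> \<in> iso (holonomy_group G1 X1 \<Phi>1 U1) (holonomy_group G2 X2 \<Phi>2 U2)"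
    and conj: "\<And>g y. g \<in> ?H1 \<Longrightarrow> y \<in> topspace (subtopology X1 U1) \<Longrightarrow> g y = h' (\<Theta> g (h y))"
    using iso unfolding isomorphic_actions_def car1 by blast
  \<comment> \<open>Surjectivity of \<open>\<Theta>\<close> supplies the backward half of the
    correspondence of return maps.\<close>
  have im: "\<Theta> ` ?H1 = ?H2" using \<Theta> unfolding iso_def bij_betw_def car1 car2 by blast
  have "steinitz_index (subtopology X1 U1) ?H1 = steinitz_index (subtopology X2 U2) ?H2"
  proof (rule steinitz_index_transport[OF h A1.return_maps_image[OF U1] A2.return_maps_image[OF U2]])
    show "\<exists>g\<in>?H2. \<forall>y\<in>topspace (subtopology X1 U1). f y = h' (g (h y))" if "f \<in> ?H1" for f
      using conj[OF that] im that by blast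
    show "\<exists>f\<in>?H1. \<forall>y\<in>topspace (subtopology X1 U1). f y = h' (g (h y))" if g: "g \<in> ?H2" for g
    proof -
      obtain f where f: "f \<in> ?H1" "g = \<Theta> f" using g im by blast
      show ?thesis unfolding f(2) by (intro bexI[OF _ f(1)] ballI conj[OF f(1)])
    qed
  qed
  moreover define c1 c2 where "c1 = card (translates (\<Phi>1 ` carrier G1) U1)"
    and "c2 = card (translates (\<Phi>2 ` carrier G2) U2)"
  moreover define P1 P2 where "P1 = rel_steinitz_order G1 X1 d1 \<Phi>1 x1"
    and "P2 = rel_steinitz_order G2 X2 d2 \<Phi>2 x2"
  \<comment> \<open>\<open>P1\<close> and \<open>P2\<close> are \<open>c1\<close> and
    \<open>c2\<close> times the common index of the return maps; multiplying each by the other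
    constant makes them equal.\<close>
  ultimately have "steinitz_of_nat c2 * P1 = steinitz_of_nat c1 * P2"
    using A1.steinitz_index_restrict[OF U1] A2.steinitz_index_restrict[OF U2]
      rel_steinitz_order_eq_index[OF assms(1,2,6,8)] rel_steinitz_order_eq_index[OF assms(3,4,7,9)]
    by (simp add: mult.left_commute)
  moreover have "1 \<le> c1" "1 \<le> c2"
    using A1.card_translates_pos[OF U1] A2.card_translates_pos[OF U2] by (auto simp: c1_def c2_def)
  ultimately have "(P1, P2) \<in> asymp_equiv_steinitz" unfolding asymp_equiv_steinitz_def by blast
  then show ?thesis
    unfolding rel_asymp_steinitz_order_def asymp_class_def P1_def P2_def
    by (rule equiv_class_eq[OF equiv_asymp_equiv_steinitz])
qed

end
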